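(* Let $n,k$ be positive integers. The Carathéodory numbers of the Veronese varieties satisfy the following: (1) $\kappa(V(n,2))=n+1$; (2) (di Dio and Kummer) $\kappa(V(n,2k))\ \ge\ \binom{2k+n}{n}-n\binom{k+n}{n}+\binom{n}{2}$; (3) $\kappa(\hat V(n+1,2k))\ \le\ \binom{2k+n}{n}-n-1$; (4) $\kappa(V(n,2k))\ \le\ \kappa(V(n,2k+1))\ \le\ \kappa(V(n,2k+2))$.
   Context: Let $m(n,D)=\binom{n+D}{n}$. The real affine Veronese variety $V(n,D)\subset\mathbb{R}^{m(n,D)-1}$ is the image of the map $v:\mathbb{R}^n\to\mathbb{R}^{m(n,D)-1}$ sending a point to the vector of all nonconstant monomials in its $n$ coordinates of degree at most $D$. The real Veronese cone $\hat V(n+1,D)\subset\mathbb{R}^{m(n,D)}$ is the image of the map $\hat v:\mathbb{R}^{n+1}\to\mathbb{R}^{m(n,D)}$ sending a point to the vector of all monomials in its $n+1$ coordinates of degree exactly $D$. For a subset $S$ of a real vector space, the Carathéodory number $\kappa(S)$ is the minimal integer such that every point of the convex hull $\mathrm{conv}(S)$ is a convex combination of at most $\kappa(S)$ points of $S$.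
   Formalization: Part (3) is stated only for (n,k) ≠ (1,1), since for n = k = 1 the printed bound is 1 while (1/2, 0, 1/2) lies in the convex hull of the cone {(a², ab, b²)} but not in the cone, so κ ≥ 2. *)

theory Defs
  imports "HOL-Analysis.Analysis" "HOL-Analysis.Finite_Function_Topology"
begin

section \<open>Caratheodory numbers\<close>

text \<open>
  A point is a convex combination of at most \<open>N\<close> points of \<open>S\<close> iff it lies in the convex hull of
  some finite subset of \<open>S\<close> with at most \<open>N\<close> elements.  The \<open>LEAST\<close> is meaningful only if some
  \<open>N\<close> works for all points of the hull; by Caratheodory's theorem this is so whenever \<open>S\<close> spans
  a finite-dimensional space, as every Veronese variety below does.
\<close>

definition caratheodory_number :: "'a::real_vector set \<Rightarrow> nat" where
  "caratheodory_number S =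
    (LEAST N. \<forall>x \<in> convex hull S. \<exists>T. T \<subseteq> S \<and> finite T \<and> card T \<le> N \<and> x \<in> convex hull T)"

section \<open>Veronese varieties\<close>

text \<open>
  Points of \<open>n\<close>-space are real lists of length \<open>n\<close>, and a monomial in \<open>n\<close> variables is given by its
  list of exponents.  A vector whose entries are indexed by a finite set \<open>E\<close> of exponent lists is a
  finitely supported function vanishing outside \<open>E\<close>.  Thus the coordinate spaces for all \<open>n\<close> and
  \<open>D\<close> lie in one real vector space, and the embedding does not affect convex hulls.
\<close>

definition monomials_le :: "nat \<Rightarrow> nat \<Rightarrow> nat list set" where
  "monomials_le n D = {\<alpha>. length \<alpha> = n \<and> sum_list \<alpha> \<le> D}"

definition monomials_eq :: "nat \<Rightarrow> nat \<Rightarrow> nat list set" where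
  "monomials_eq n D = {\<alpha>. length \<alpha> = n \<and> sum_list \<alpha> = D}"

definition monomial_value :: "nat list \<Rightarrow> real list \<Rightarrow> real" where
  "monomial_value \<alpha> x = (\<Prod>i<length \<alpha>. x ! i ^ (\<alpha> ! i))"

definition monomial_vector :: "nat list set \<Rightarrow> real list \<Rightarrow> (nat list \<Rightarrow>\<^sub>0 real)" where
  "monomial_vector E x = (\<Sum>\<alpha>\<in>E. Poly_Mapping.single \<alpha> (monomial_value \<alpha> x))"

text \<open>The exponent list of the constant monomial is \<open>replicate n 0\<close>.\<close>

definition affine_veronese :: "nat \<Rightarrow> nat \<Rightarrow> (nat list \<Rightarrow>\<^sub>0 real) set" where
  "affine_veronese n D =
    monomial_vector (monomials_le n D - {replicate n 0}) ` {x. length x = n}"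

text \<open>The first argument is the number of homogeneous coordinates.\<close>

definition veronese_cone :: "nat \<Rightarrow> nat \<Rightarrow> (nat list \<Rightarrow>\<^sub>0 real) set" where
  "veronese_cone n D = monomial_vector (monomials_eq n D) ` {x. length x = n}"

lemma bij_betw_monomials: "bij_betw tl (monomials_eq (Suc n) D) (monomials_le n D)"
  by (rule bij_betw_byWitness[where f' = "\<lambda>\<alpha>. (D - sum_list \<alpha>) # \<alpha>"])
     (auto simp: monomials_eq_def monomials_le_def length_Suc_conv)

lemma card_monomials_le: "card (monomials_le n D) = (n + D) choose n"
proof -
  have "card (monomials_le n D) = card (monomials_eq (Suc n) D)"
    by (metis bij_betw_monomials bij_betw_same_card)
  also have "\<dots> = (D + n) choose D"
    by (simp add: monomials_eq_def card_length_sum_list)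
  also have "\<dots> = (n + D) choose n"
    by (metis add.commute binomial_symmetric diff_add_inverse le_add1)
  finally show ?thesis .
qed

lemma finite_monomials_le: "finite (monomials_le n D)"
  by (rule card_ge_0_finite) (simp add: card_monomials_le)

lemma finite_monomials_eq: "finite (monomials_eq n D)"
  by (rule finite_subset[OF _ finite_monomials_le[of n D]])
     (auto simp: monomials_eq_def monomials_le_def)

lemma lookup_monomial_vector:
  assumes "finite E"
  shows "Poly_Mapping.lookup (monomial_vector E x) \<alpha> = (if \<alpha> \<in> E then monomial_value \<alpha> x else 0)"
  using assms by (simp add: monomial_vector_def lookup_sum lookup_single when_def)

section \<open>An exceptional case\<close>

text \<open>
  The inequality \<open>caratheodory_number (veronese_cone (n + 1) (2 * k)) \<le> (2 * k + n choose n) - n - 1\<close>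
  fails for \<open>n = k = 1\<close>: its right-hand side is then 1, but the midpoint of the images of
  \<open>(1, 0)\<close> and \<open>(0, 1)\<close> is not in the cone.
\<close>

lemma caratheodory_number_veronese_cone_2_2: "2 \<le> caratheodory_number (veronese_cone 2 2)"
proof -
  let ?S = "veronese_cone 2 2"
  let ?P = "\<lambda>N. \<forall>x \<in> convex hull ?S. \<exists>T. T \<subseteq> ?S \<and> finite T \<and> card T \<le> N \<and> x \<in> convex hull T"
  define f :: "real \<times> real \<times> real \<Rightarrow> (nat list \<Rightarrow>\<^sub>0 real)" where
    "f = (\<lambda>(a, b, c). Poly_Mapping.single [2,0] a + Poly_Mapping.single [1,1] b
                      + Poly_Mapping.single [0,2] c)"
  have lookup_scaleR: "Poly_Mapping.lookup (r *\<^sub>R p) i = r * Poly_Mapping.lookup p i"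
    for r i and p :: "(nat list \<Rightarrow>\<^sub>0 real)"
    by (simp add: scaleR_poly_mapping_def)
  have lin: "linear f"
    by (rule linearI) (auto simp: f_def split_beta intro!: poly_mapping_eqI
        simp: lookup_add lookup_scaleR lookup_single when_def)
  have E: "monomials_eq 2 2 = {[2,0], [1,1], [0,2]}"
    by (auto simp: monomials_eq_def length_Suc_conv numeral_2_eq_2 add_eq_if split: if_splits)
  have v: "monomial_vector (monomials_eq 2 2) [a, b] = f (a^2, a * b, b^2)" for a b
    by (simp add: E monomial_vector_def monomial_value_def f_def lessThan_Suc ac_simps)
  have S: "?S = f ` {(a^2, a * b, b^2) | a b. True}"
  proof -
    have "{x :: real list. length x = 2} = {[a, b] | a b. True}"
      by (auto simp: length_Suc_conv numeral_2_eq_2)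
    then have "?S = {monomial_vector (monomials_eq 2 2) [a, b] | a b. True}"
      by (auto simp: veronese_cone_def)
    then show ?thesis
      by (auto simp: v)
  qed
  have "?P (DIM(real \<times> real \<times> real) + 1)"
  proof
    fix x assume "x \<in> convex hull ?S"
    then obtain y where y: "x = f y" "y \<in> convex hull {(a^2, a * b, b^2) | a b. True}"
      by (auto simp: S convex_hull_linear_image[OF lin, symmetric])
    then obtain T where T: "finite T" "T \<subseteq> {(a^2, a * b, b^2) | a b. True}"
        "card T \<le> DIM(real \<times> real \<times> real) + 1" "y \<in> convex hull T"
      using caratheodory[of "{(a^2, a * b, b^2) | a b :: real. True}"] by blast
    have "f ` T \<subseteq> ?S" "finite (f ` T)" "card (f ` T) \<le> DIM(real \<times> real \<times> real) + 1"
         "x \<in> convex hull (f ` T)"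
      using T y card_image_le[OF T(1), of f]
      by (auto simp: S convex_hull_linear_image[OF lin, symmetric])
    then show "\<exists>T. T \<subseteq> ?S \<and> finite T \<and> card T \<le> DIM(real \<times> real \<times> real) + 1 \<and> x \<in> convex hull T"
      by blast
  qed
  then have P: "?P (caratheodory_number ?S)"
    unfolding caratheodory_number_def by (rule LeastI)
  define x where "x = f (1/2, 0, 1/2)"
  have "f (a^2, a * b, b^2) \<in> ?S" for a b
    unfolding S by blast
  from this[of 1 0] this[of 0 1] have "f (1, 0, 0) \<in> ?S" "f (0, 0, 1) \<in> ?S"
    by simp_all
  moreover have "x = (1/2) *\<^sub>R f (1, 0, 0) + (1/2) *\<^sub>R f (0, 0, 1)"
  proof -
    have "x = f ((1/2) *\<^sub>R (1, 0, 0) + (1/2) *\<^sub>R (0, 0, 1))"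
      by (simp add: x_def)
    then show ?thesis
      by (simp only: linear_add[OF lin] linear_scale[OF lin])
  qed
  ultimately have "x \<in> convex hull ?S"
    by (simp add: convexD[OF convex_convex_hull] hull_inc)
  then obtain T where T: "T \<subseteq> ?S" "finite T" "card T \<le> caratheodory_number ?S" "x \<in> convex hull T"
    using P by blast
  have "x \<notin> ?S"
  proof
    assume "x \<in> ?S"
    then obtain a b where "x = f (a^2, a * b, b^2)"
      by (auto simp: S)
    then have "Poly_Mapping.lookup (f (1/2, 0, 1/2)) i = Poly_Mapping.lookup (f (a^2, a * b, b^2)) i" for i
      by (simp add: x_def)
    from this[of "[2,0]"] this[of "[1,1]"] this[of "[0,2]"] show False
      by (auto simp: f_def lookup_add lookup_single when_def)
  qed
  show ?thesis
  proof (rule ccontr)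
    assume "\<not> ?thesis"
    then have "card T = 0 \<or> card T = 1"
      using T by linarith
    then have "T = {} \<or> (\<exists>t. T = {t})"
      using T by (auto simp: card_1_singleton_iff)
    then have "x \<in> T"
      using T by auto
    then show False
      using T \<open>x \<notin> ?S\<close> by blast
  qed
qed

end

(*
  (1) A covariance matrix is a sum of n rank-one matrices, and splitting an atom v of weight p into
  v + u / sqrt p and v - u / sqrt p realises each of them at the cost of one atom.  Conversely, for
  at most n atoms the square of some nonzero affine function has integral 0.

  (2) Measures on the grid {0..<k}^n are the only nonnegative measures that annihilate the sum over i of
  prod_g (x_i - g)^2, which has degree 2k.  The monomials of degree at most 2k with all exponents
  below k are linearly independent on the grid, so a generic measure on the grid needs as many atoms
  as there are such monomials.

  (3) For k = 1 the number is at most n + 1 by diagonalisation.  For k >= 2 remove as much as possible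
  of one point of the cone; the remainder is annihilated by a nonzero nonnegative form f, so all its
  points are singular zeros of f.  Two linearly independent forms of degree 2k - 1 vanish there,
  and multiplying them by the coordinates gives n + 2 independent forms of degree 2k.  Hence the
  remainder needs at most m - (n + 2) points, where m is the dimension of the space of forms.

  (4) Lift a convex combination to the higher degree, shorten it there, and project.
*)

theory Submission
  imports Defs
begin

section \<open>Linear algebra\<close>

text \<open>The bound in (3) is the count (m - (n + 2)) + 1, the last term being the removed point.
  Two independent forms of degree 2k - 1 through the zeros of f are found among its partial
  derivatives, unless these are all multiples of one form. In that case f is a constant times the
  2k-th power of a linear form l, and multiples of l replace the derivatives. In degree 2k - 1 there
  are two independent multiples of l only if k >= 2, which is why k = 1 is treated apart. The
  largest removable multiple of a point exists because in even degree the coordinates of the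
  monomials x_j^(2k) bound all points of a representation, so that representations of fixed length
  form a compact set. In (2) the support of a shorter representation is unknown when the measure is
  chosen. Only finitely many subsets of the grid compete, however. Each is annihilated by a nonzero
  polynomial fixed beforehand, and the weights are distinct powers of one parameter t, so that the
  integrals to be kept away from 0 are nonzero polynomials in t up to a common factor.\<close>

lemma underdetermined_system:
  fixes M :: "'b \<Rightarrow> 'a \<Rightarrow> real"
  assumes "finite T" "finite A" "card T < card A"
  shows "\<exists>c. (\<exists>a\<in>A. c a \<noteq> 0) \<and> (\<forall>t\<in>T. (\<Sum>a\<in>A. M t a * c a) = 0)"
  using assms
proof (induction T arbitrary: M A rule: finite_induct)
  case empty
  then obtain a where "a \<in> A" by fastforce
  then show ?case by (intro exI[of _ "\<lambda>_. 1"]) auto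
next
  case (insert s T)
  show ?case
  proof (cases "\<forall>a\<in>A. M s a = 0")
    case True
    have "card T < card A" using insert by simp
    from insert.IH[OF insert.prems(1) this, of M] obtain c where
      "\<exists>a\<in>A. c a \<noteq> 0" "\<forall>t\<in>T. (\<Sum>a\<in>A. M t a * c a) = 0" by blast
    with True show ?thesis by (intro exI[of _ c]) auto
  next
    case False
    then obtain b where b: "b \<in> A" "M s b \<noteq> 0" by blast
    let ?A = "A - {b}"
    \<comment> \<open>Row \<open>t\<close> after the unknown \<open>b\<close> has been eliminated by
      means of row \<open>s\<close>.\<close>
    let ?M = "\<lambda>t a. M t a - M t b * M s a / M s b"
    have "card T < card ?A" using insert b by simp
    from insert.IH[OF _ this, of ?M] insert.prems obtain c where
      c: "\<exists>a\<in>?A. c a \<noteq> 0" "\<forall>t\<in>T. (\<Sum>a\<in>?A. ?M t a * c a) = 0" by auto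
    \<comment> \<open>Back substitution: this value at \<open>b\<close> solves row
      \<open>s\<close>.\<close>
    define d where "d = c(b := - (\<Sum>a\<in>?A. M s a * c a) / M s b)"
    have d_sum: "(\<Sum>a\<in>A. M t a * d a) = M t b * d b + (\<Sum>a\<in>?A. M t a * c a)" for t
      using b insert.prems by (subst sum.remove[of A b]) (auto simp: d_def intro!: sum.cong)
    have "(\<Sum>a\<in>A. M t a * d a) = (\<Sum>a\<in>?A. ?M t a * c a)" for t
      unfolding d_sum
      by (simp add: d_def left_diff_distrib sum_subtractf sum_divide_distrib sum_distrib_left mult.assoc)
    moreover have "(\<Sum>a\<in>A. M s a * d a) = 0"
      unfolding d_sum using b by (simp add: d_def)
    ultimately have "\<forall>t\<in>insert s T. (\<Sum>a\<in>A. M t a * d a) = 0"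
      using c by auto
    moreover have "\<exists>a\<in>A. d a \<noteq> 0"
      using c(1) by (auto simp: d_def)
    ultimately show ?thesis by blast
  qed
qed

text \<open>Caratheodory's exchange argument. The bound \<open>r\<close> is not tied to a dimension:
  it is any size beyond which every subfamily is dependent, so that points on the common zeros of
  many forms can be reduced further than points in general.\<close>

lemma conic_reduction:
  fixes \<phi> :: "'i \<Rightarrow> 'a::real_vector"
  assumes "finite I" "\<And>i. i \<in> I \<Longrightarrow> 0 \<le> w i"
    and "\<And>J. J \<subseteq> I \<Longrightarrow> r < card J \<Longrightarrow> \<exists>c. (\<exists>i\<in>J. c i \<noteq> 0) \<and> (\<Sum>i\<in>J. c i *\<^sub>R \<phi> i) = 0"
  shows "\<exists>J w'. J \<subseteq> I \<and> card J \<le> r \<and> (\<forall>i\<in>J. 0 \<le> w' i) \<and>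
            (\<Sum>i\<in>J. w' i *\<^sub>R \<phi> i) = (\<Sum>i\<in>I. w i *\<^sub>R \<phi> i)"
  using assms
proof (induction "card I" arbitrary: I w rule: less_induct)
  case less
  show ?case
  proof (cases "card I \<le> r")
    case True
    then show ?thesis using less.prems by blast
  next
    case False
    then obtain c0 where c0: "\<exists>i\<in>I. c0 i \<noteq> 0" "(\<Sum>i\<in>I. c0 i *\<^sub>R \<phi> i) = 0"
      using less.prems(3)[of I] by auto
    \<comment> \<open>Negating the relation if necessary makes some coefficient positive, so that
      the minimum below ranges over a nonempty set.\<close>
    obtain c where c: "\<exists>i\<in>I. c i > 0" "(\<Sum>i\<in>I. c i *\<^sub>R \<phi> i) = 0"
    proof (cases "\<exists>i\<in>I. c0 i > 0")
      case True
      then show ?thesis using that c0 by blast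
    next
      case False
      then have "\<exists>i\<in>I. - c0 i > 0" using c0(1) by force
      moreover have "(\<Sum>i\<in>I. (- c0 i) *\<^sub>R \<phi> i) = 0" using c0(2) by (simp add: sum_negf)
      ultimately show ?thesis using that[of "\<lambda>i. - c0 i"] by blast
    qed
    let ?P = "{i\<in>I. c i > 0}"
    \<comment> \<open>The largest multiple of the relation that can be subtracted while all weights
      stay nonnegative; at a minimising index the weight becomes 0.\<close>
    define s where "s = Min ((\<lambda>i. w i / c i) ` ?P)"
    have fin: "finite ?P" "?P \<noteq> {}" using less.prems(1) c(1) by auto
    then have "s \<in> (\<lambda>i. w i / c i) ` ?P" unfolding s_def by (intro Min_in) auto
    then obtain j where j: "j \<in> I" "c j > 0" "s = w j / c j" by auto
    have s_le: "s \<le> w i / c i" if "i \<in> I" "c i > 0" for i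
      unfolding s_def using fin that by (intro Min_le) auto
    have "0 \<le> s" using j less.prems(2) by simp
    define w1 where "w1 = (\<lambda>i. w i - s * c i)"
    have w1: "0 \<le> w1 i" if "i \<in> I" for i
    proof (cases "c i > 0")
      case True
      then show ?thesis using s_le[OF that True] by (simp add: w1_def pos_le_divide_eq)
    next
      case False
      then have "s * c i \<le> 0" using \<open>0 \<le> s\<close> by (simp add: mult_nonneg_nonpos)
      then show ?thesis using less.prems(2)[OF that] by (simp add: w1_def)
    qed
    have w1j: "w1 j = 0" using j by (simp add: w1_def)
    have "(\<Sum>i\<in>I. w i *\<^sub>R \<phi> i) = (\<Sum>i\<in>I. w1 i *\<^sub>R \<phi> i) + s *\<^sub>R (\<Sum>i\<in>I. c i *\<^sub>R \<phi> i)"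
      by (simp add: w1_def scaleR_left_diff_distrib sum_subtractf scaleR_sum_right)
    also have "\<dots> = (\<Sum>i\<in>I - {j}. w1 i *\<^sub>R \<phi> i)"
      using less.prems(1) j(1) w1j by (simp add: c(2) sum.remove[of I j])
    finally have eq: "(\<Sum>i\<in>I. w i *\<^sub>R \<phi> i) = (\<Sum>i\<in>I - {j}. w1 i *\<^sub>R \<phi> i)" .
    have "card (I - {j}) < card I" using j less.prems(1) by (meson card_Diff1_less)
    have "\<exists>J w'. J \<subseteq> I - {j} \<and> card J \<le> r \<and> (\<forall>i\<in>J. 0 \<le> w' i) \<and>
        (\<Sum>i\<in>J. w' i *\<^sub>R \<phi> i) = (\<Sum>i\<in>I - {j}. w1 i *\<^sub>R \<phi> i)"
    proof (rule less.hyps[OF \<open>card (I - {j}) < card I\<close>])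
      show "\<exists>c. (\<exists>i\<in>J. c i \<noteq> 0) \<and> (\<Sum>i\<in>J. c i *\<^sub>R \<phi> i) = 0" if "J \<subseteq> I - {j}" "r < card J" for J
        using less.prems(3)[of J] that by blast
    qed (use less.prems(1) w1 in auto)
    then show ?thesis unfolding eq by (meson Diff_subset subset_trans)
  qed
qed

text \<open>Algebraic Hahn--Banach: extend the functional one basis vector at a time.\<close>

lemma positive_functional:
  fixes K :: "'a::real_vector set"
  assumes "finite B" and K0: "0 \<in> K"
    and add: "\<And>x y. x \<in> K \<Longrightarrow> y \<in> K \<Longrightarrow> x + y \<in> K"
    and scale: "\<And>c x. 0 \<le> c \<Longrightarrow> x \<in> K \<Longrightarrow> c *\<^sub>R x \<in> K"
    and u: "- u \<notin> K"
    and unit: "\<And>b. b \<in> B \<Longrightarrow> \<exists>s. s *\<^sub>R u - b \<in> K \<and> s *\<^sub>R u + b \<in> K"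
  shows "\<exists>p::'a \<Rightarrow> real. linear p \<and> p u = 1 \<and> (\<forall>v\<in>K \<inter> span (insert u B). 0 \<le> p v)"
  using assms(1) unit
proof (induction B rule: finite_induct)
  case empty
  have "u \<noteq> 0" using K0 u by auto
  then have "independent {u}" by (simp add: dependent_single)
  from linear_independent_extend[OF this, of "\<lambda>_. 1::real"] obtain p :: "'a \<Rightarrow> real"
    where p: "linear p" "p u = 1" by auto
  have "0 \<le> p v" if "v \<in> K" "v \<in> span {u}" for v
  proof -
    from \<open>v \<in> span {u}\<close> obtain c where c: "v = c *\<^sub>R u" by (auto simp: span_singleton)
    have "0 \<le> c"
    proof (rule ccontr)
      assume "\<not> 0 \<le> c"
      then have "- u = (- 1 / c) *\<^sub>R v" "0 \<le> - 1 / c" using c by auto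
      then show False using scale[of "- 1 / c" v] \<open>v \<in> K\<close> u by simp
    qed
    then show ?thesis using c p by (simp add: linear_scale)
  qed
  then show ?case using p by blast
next
  case (insert b B)
  define W where "W = span (insert u B)"
  obtain p where p: "linear p" "p u = 1" "\<And>v. v \<in> K \<Longrightarrow> v \<in> W \<Longrightarrow> (0::real) \<le> p v"
    using insert unfolding W_def by auto
  have sW: "subspace W" by (simp add: W_def)
  have ins: "insert u (insert b B) = insert b (insert u B)" by blast
  show ?case
  proof (cases "b \<in> W")
    case True
    then have "span (insert u (insert b B)) = W"
      unfolding ins W_def by (rule span_redundant)
    then show ?thesis using p by auto
  next
    case False
    \<comment> \<open>\<open>linear_independent_extend\<close> starts from an independent set, so
      the spanning set of \<open>W\<close> is thinned to a basis before \<open>b\<close> is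
      added.\<close>
    obtain BW where BW: "BW \<subseteq> insert u B" "independent BW" "insert u B \<subseteq> span BW"
      using maximal_independent_subset by blast
    have spBW: "span BW = W"
      unfolding W_def using BW by (metis span_mono span_span subset_antisym)
    have ind: "independent (insert b BW)"
      using BW(2) False spBW by (simp add: independent_insert)
    \<comment> \<open>The value \<open>r\<close> at \<open>b\<close> has to satisfy
      \<open>- p w <= r\<close> whenever \<open>w + b\<close> is in \<open>K\<close>, and
      \<open>r <= p w'\<close> whenever \<open>w' - b\<close> is in \<open>K\<close>. By
      \<open>cross\<close> every lower bound is at most every upper bound; the order-unit hypothesis
      provides at least one of each, so the supremum of the lower bounds works.\<close>
    define L where "L = {- p w | w. w \<in> W \<and> w + b \<in> K}"
    define r where "r = Sup L"
    obtain s where s: "s *\<^sub>R u - b \<in> K" "s *\<^sub>R u + b \<in> K" using insert.prems by blast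
    have uW: "s *\<^sub>R u \<in> W" by (simp add: W_def span_base span_scale)
    have cross: "- p w \<le> p w'" if "w \<in> W" "w + b \<in> K" "w' \<in> W" "w' - b \<in> K" for w w'
    proof -
      have "w + w' \<in> K" using add[OF that(2,4)] by simp
      then have "0 \<le> p (w + w')" using p(3) that sW by (simp add: subspace_add)
      then show ?thesis using p(1) by (simp add: linear_add)
    qed
    have Lne: "L \<noteq> {}" unfolding L_def using s uW by blast
    have bdd: "bdd_above L"
      unfolding L_def using cross[OF _ _ uW s(1)] by (intro bdd_aboveI[of _ "p (s *\<^sub>R u)"]) auto
    have r1: "- p w \<le> r" if "w \<in> W" "w + b \<in> K" for w
      unfolding r_def using that by (intro cSup_upper bdd) (auto simp: L_def)
    have r2: "r \<le> p w" if "w \<in> W" "w - b \<in> K" for w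
      unfolding r_def using that cross by (intro cSup_least Lne) (auto simp: L_def)
    obtain g :: "'a \<Rightarrow> real" where g: "linear g" "\<forall>x\<in>insert b BW. g x = (if x = b then r else p x)"
      using linear_independent_extend[OF ind, of "\<lambda>x. if x = b then r else p x"] by blast
    have gb: "g b = r" using g by simp
    have "b \<notin> BW" using False spBW span_base by blast
    then have "g x = p x" if "x \<in> BW" for x using g(2) that by auto
    then have gW: "g x = p x" if "x \<in> W" for x
      using linear_eq_on_span[OF g(1) p(1)] that spBW by blast
    have "0 \<le> g v" if v: "v \<in> K" "v \<in> span (insert u (insert b B))" for v
    proof -
      from v(2) obtain t where t: "v - t *\<^sub>R b \<in> W"
        unfolding ins W_def by (auto simp: span_insert)
      define w where "w = v - t *\<^sub>R b"
      have w: "w \<in> W" "v = w + t *\<^sub>R b" using t by (auto simp: w_def)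
      have gv: "g v = p w + t * r" using w g(1) gW gb by (simp add: linear_add linear_scale)
      have sc: "c *\<^sub>R w \<in> W" for c using w sW by (simp add: subspace_scale)
      \<comment> \<open>Dividing by the absolute value of \<open>t\<close> reduces the last two
        cases to vectors of the form \<open>w + b\<close> and \<open>w - b\<close>.\<close>
      consider "t = 0" | "t > 0" | "t < 0" by linarith
      then show ?thesis
      proof cases
        case 1
        then show ?thesis using gv w v(1) p(3) by simp
      next
        case 2
        have "(1/t) *\<^sub>R w + b = (1/t) *\<^sub>R v" using w(2) 2 by (simp add: scaleR_add_right)
        then have "(1/t) *\<^sub>R w + b \<in> K" using scale[of "1/t" v] v(1) 2 by simp
        from r1[OF sc this] have "- (p w / t) \<le> r" using p(1) by (simp add: linear_scale)
        then show ?thesis using gv 2 by (simp add: field_simps)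
      next
        case 3
        have "(-1/t) *\<^sub>R w - b = (-1/t) *\<^sub>R v" using w(2) 3 by (simp add: scaleR_add_right)
        then have "(-1/t) *\<^sub>R w - b \<in> K" using scale[of "-1/t" v] v(1) 3 by simp
        from r2[OF sc this] have "r \<le> - (p w / t)" using p(1) by (simp add: linear_scale linear_neg)
        then show ?thesis using gv 3 by (simp add: field_simps)
      qed
    qed
    moreover have "g u = 1" using gW[of u] p(2) by (simp add: W_def span_base)
    ultimately show ?thesis using g(1) by blast
  qed
qed

text \<open>Cholesky factorisation: the row of \<open>s\<close> divided by the root of its diagonal
  entry gives one square, and the Schur complement is again positive semidefinite. The number of
  squares is the size of \<open>A\<close>; the numbers of points in degree two come from
  here.\<close>

lemma psd_sum_of_squares:
  fixes B :: "'a \<Rightarrow> 'a \<Rightarrow> real"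
  assumes "finite A" "\<And>a b. B a b = B b a"
    and "\<And>c. 0 \<le> (\<Sum>a\<in>A. \<Sum>b\<in>A. c a * c b * B a b)"
  shows "\<exists>u. \<forall>a\<in>A. \<forall>b\<in>A. B a b = (\<Sum>j\<in>A. u j a * u j b)"
  using assms
proof (induction A arbitrary: B rule: finite_induct)
  case empty
  then show ?case by simp
next
  case (insert s A)
  note sym = insert.prems(1)
  define d where "d = B s s"
  define l where "l = (\<lambda>c. \<Sum>a\<in>A. c a * B s a)"
  define q where "q = (\<lambda>c. \<Sum>a\<in>A. \<Sum>b\<in>A. c a * c b * B a b)"
  have psd: "0 \<le> t\<^sup>2 * d + 2 * t * l c + q c" for t c
  proof -
    let ?c = "c(s := t)"
    have in1: "(\<Sum>a\<in>A. f a (?c a)) = (\<Sum>a\<in>A. f a (c a))" for f :: "'a \<Rightarrow> real \<Rightarrow> real"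
      using insert.hyps by (intro sum.cong) auto
    have "(\<Sum>a\<in>insert s A. \<Sum>b\<in>insert s A. ?c a * ?c b * B a b)
        = t * t * d + (\<Sum>b\<in>A. t * ?c b * B s b) +
          ((\<Sum>a\<in>A. ?c a * t * B a s) + (\<Sum>a\<in>A. \<Sum>b\<in>A. ?c a * ?c b * B a b))"
      using insert.hyps by (simp add: sum.distrib d_def del: fun_upd_apply) (simp add: fun_upd_same)
    also have "(\<Sum>b\<in>A. t * ?c b * B s b) = t * l c"
      by (subst in1[of "\<lambda>b y. t * y * B s b"]) (simp add: l_def sum_distrib_left mult.assoc)
    also have "(\<Sum>a\<in>A. ?c a * t * B a s) = t * l c"
      by (subst in1[of "\<lambda>b y. y * t * B b s"]) (simp add: l_def sum_distrib_left sym[of _ s] ac_simps)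
    also have "(\<Sum>a\<in>A. \<Sum>b\<in>A. ?c a * ?c b * B a b) = q c"
      unfolding q_def using insert.hyps by (intro sum.cong) auto
    finally show ?thesis using insert.prems(2)[of ?c] by (simp add: power2_eq_square)
  qed
  have "d \<ge> 0" using psd[of 1 "\<lambda>_. 0"] by (simp add: l_def q_def)
  define e where "e = (\<lambda>a. if d = 0 then 0 else B s a / sqrt d)"
  define B' where "B' = (\<lambda>a b. B a b - e a * e b)"
  \<comment> \<open>For \<open>d = 0\<close> the form is affine in \<open>t\<close>, so a nonzero
    slope would make it negative somewhere; the witness gives the value -1.\<close>
  have l0: "l c = 0" if "d = 0" for c
  proof (rule ccontr)
    assume "l c \<noteq> 0"
    moreover have "2 * (- (q c + 1) / (2 * l c)) * l c + q c = - 1"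
      using \<open>l c \<noteq> 0\<close> by (simp add: field_simps)
    ultimately show False using psd[of "- (q c + 1) / (2 * l c)" c] that by simp
  qed
  have Bs: "B s a = 0" if "d = 0" "a \<in> A" for a
  proof -
    have "l (\<lambda>b. if b = a then 1 else 0) = B s a"
      using insert.hyps that(2) by (simp add: l_def if_distrib[of "\<lambda>x. x * _"] cong: if_cong)
    then show ?thesis using l0[OF that(1)] by simp
  qed
  have ee: "e s * e a = B s a" if "a \<in> insert s A" for a
    using that Bs[of a] \<open>d \<ge> 0\<close> by (auto simp: e_def d_def[symmetric] field_simps)
  have "\<exists>u. \<forall>a\<in>A. \<forall>b\<in>A. B' a b = (\<Sum>j\<in>A. u j a * u j b)"
  proof (rule insert.IH)
    show "B' a b = B' b a" for a b by (simp add: B'_def sym[of a b])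
    show "0 \<le> (\<Sum>a\<in>A. \<Sum>b\<in>A. c a * c b * B' a b)" for c
    proof -
      define m where "m = (\<Sum>a\<in>A. c a * e a)"
      have "(\<Sum>a\<in>A. \<Sum>b\<in>A. c a * c b * (e a * e b)) = m * m"
        unfolding m_def sum_product by (simp add: ac_simps)
      then have eq: "(\<Sum>a\<in>A. \<Sum>b\<in>A. c a * c b * B' a b) = q c - m\<^sup>2"
        by (simp add: B'_def q_def right_diff_distrib sum_subtractf power2_eq_square)
      show ?thesis
      proof (cases "d = 0")
        case True
        then have "m = 0" by (simp add: m_def e_def)
        then show ?thesis using eq psd[of 0 c] by simp
      next
        case False
        then have "d > 0" using \<open>d \<ge> 0\<close> by simp
        have "m = l c / sqrt d" using False by (simp add: m_def e_def l_def sum_divide_distrib)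
        then have m2: "m\<^sup>2 = (l c)\<^sup>2 / d" using \<open>d > 0\<close> by (simp add: power_divide)
        \<comment> \<open>\<open>t = - l c / d\<close> minimises the quadratic in \<open>t\<close>,
          and the minimum is the Schur complement evaluated at \<open>c\<close>.\<close>
        have "(- l c / d)\<^sup>2 * d + 2 * (- l c / d) * l c = - ((l c)\<^sup>2 / d)"
          using \<open>d > 0\<close> by (simp add: power2_eq_square field_simps)
        then show ?thesis using psd[of "- l c / d" c] eq m2 by simp
      qed
    qed
  qed
  then obtain u where u: "\<forall>a\<in>A. \<forall>b\<in>A. B' a b = (\<Sum>j\<in>A. u j a * u j b)" by blast
  \<comment> \<open>The vectors of the Schur complement are extended by 0 at \<open>s\<close>; the
    row and column of \<open>s\<close> come from \<open>e\<close> alone.\<close>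
  define u' where "u' = (\<lambda>j a. if j = s then e a else if a = s then 0 else u j a)"
  have sumu: "(\<Sum>j\<in>A. u' j a * u' j b) = (if a = s \<or> b = s then 0 else \<Sum>j\<in>A. u j a * u j b)" for a b
    using insert.hyps by (auto simp: u'_def intro!: sum.cong sum.neutral)
  have "B a b = (\<Sum>j\<in>insert s A. u' j a * u' j b)" if "a \<in> insert s A" "b \<in> insert s A" for a b
  proof -
    have "(\<Sum>j\<in>insert s A. u' j a * u' j b) = e a * e b + (\<Sum>j\<in>A. u' j a * u' j b)"
      using insert.hyps by (simp add: u'_def)
    also have "\<dots> = B a b"
    proof (cases "a = s \<or> b = s")
      case False
      then have "B' a b = (\<Sum>j\<in>A. u j a * u j b)" using u that by blast
      with False show ?thesis unfolding sumu by (simp add: B'_def)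
    qed (use ee[OF that(1)] ee[OF that(2)] sym[of a s] in \<open>auto simp: sumu mult.commute\<close>)
    finally show ?thesis by simp
  qed
  then show ?case by blast
qed

section \<open>Convex combinations of bounded length\<close>

text \<open>Repeated points and zero weights are allowed, so that "at most \<open>N\<close> points"
  becomes a sum of exactly \<open>N\<close> terms.\<close>

definition convex_comb :: "'a::real_vector set \<Rightarrow> nat \<Rightarrow> 'a \<Rightarrow> bool" where
  "convex_comb S N x \<longleftrightarrow>
    (\<exists>w s. (\<forall>i<N. 0 \<le> w i \<and> s i \<in> S) \<and> (\<Sum>i<N. w i) = 1 \<and> x = (\<Sum>i<N. w i *\<^sub>R s i))"

lemma convex_comb_in_hull:
  assumes "convex_comb S N x"
  shows "\<exists>T. T \<subseteq> S \<and> finite T \<and> card T \<le> N \<and> x \<in> convex hull T"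
proof -
  obtain w s where ws: "\<forall>i<N. 0 \<le> w i \<and> s i \<in> S" "(\<Sum>i<N. w i) = 1" "x = (\<Sum>i<N. w i *\<^sub>R s i)"
    using assms by (auto simp: convex_comb_def)
  have "x \<in> convex hull (s ` {..<N})"
    unfolding ws(3) using ws(1,2) by (intro convex_sum convex_convex_hull) (auto simp: hull_inc)
  moreover have "card (s ` {..<N}) \<le> N" using card_image_le[of "{..<N}" s] by simp
  ultimately show ?thesis using ws(1) by (intro exI[of _ "s ` {..<N}"]) auto
qed

lemma convex_comb_of_hull:
  assumes "T \<subseteq> S" "finite T" "card T \<le> N" "x \<in> convex hull T"
  shows "convex_comb S N x"
proof -
  obtain u where u: "\<forall>t\<in>T. 0 \<le> u t" "sum u T = 1" "x = (\<Sum>t\<in>T. u t *\<^sub>R t)"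
    using assms(4) by (auto simp: convex_hull_finite[OF assms(2)])
  then obtain t0 where t0: "t0 \<in> T" by fastforce
  obtain g where g: "bij_betw g {..<card T} T"
    using assms(2) by (metis ex_bij_betw_nat_finite atLeast0LessThan)
  let ?s = "\<lambda>i. if i < card T then g i else t0"
  let ?w = "\<lambda>i. if i < card T then u (g i) else 0"
  have sub: "{..<card T} \<subseteq> {..<N}" using assms(3) by auto
  have "(\<Sum>i<N. ?w i) = (\<Sum>i<card T. u (g i))"
    by (rule sum.mono_neutral_cong_right) (use sub in auto)
  also have "\<dots> = 1" using sum.reindex_bij_betw[OF g, of u] u(2) by simp
  finally have 1: "(\<Sum>i<N. ?w i) = 1" .
  have "(\<Sum>i<N. ?w i *\<^sub>R ?s i) = (\<Sum>i<card T. u (g i) *\<^sub>R g i)"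
    by (rule sum.mono_neutral_cong_right) (use sub in auto)
  also have "\<dots> = x" using sum.reindex_bij_betw[OF g, of "\<lambda>t. u t *\<^sub>R t"] u(3) by simp
  finally have 2: "x = (\<Sum>i<N. ?w i *\<^sub>R ?s i)" by simp
  have "g i \<in> T" if "i < card T" for i using g that by (auto simp: bij_betw_def)
  then have "\<forall>i<N. 0 \<le> ?w i \<and> ?s i \<in> S" using u(1) t0 assms(1) by auto
  then show ?thesis unfolding convex_comb_def
    by (intro exI[of _ ?w] exI[of _ ?s] conjI 1 2)
qed

lemma convex_comb_iff:
  "convex_comb S N x \<longleftrightarrow> (\<exists>T. T \<subseteq> S \<and> finite T \<and> card T \<le> N \<and> x \<in> convex hull T)"
proof
  assume "convex_comb S N x"
  then show "\<exists>T. T \<subseteq> S \<and> finite T \<and> card T \<le> N \<and> x \<in> convex hull T"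
    by (rule convex_comb_in_hull)
qed (elim exE conjE, rule convex_comb_of_hull)

lemma caratheodory_number_alt:
  "caratheodory_number S = (LEAST N. \<forall>x \<in> convex hull S. convex_comb S N x)"
  by (simp only: caratheodory_number_def convex_comb_iff)

lemma caratheodory_number_le:
  "(\<And>x. x \<in> convex hull S \<Longrightarrow> convex_comb S N x) \<Longrightarrow> caratheodory_number S \<le> N"
  unfolding caratheodory_number_alt by (rule Least_le) (intro ballI)

lemma convex_comb_caratheodory_number:
  assumes "\<And>x. x \<in> convex hull S \<Longrightarrow> convex_comb S N x" "x \<in> convex hull S"
  shows "convex_comb S (caratheodory_number S) x"
proof -
  have "\<forall>x\<in>convex hull S. convex_comb S (caratheodory_number S) x"
    unfolding caratheodory_number_alt by (rule LeastI[of _ N]) (intro ballI assms(1))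
  then show ?thesis using assms(2) by blast
qed

lemma hull_imp_convex_comb: "x \<in> convex hull S \<Longrightarrow> \<exists>N. convex_comb S N x"
proof -
  assume "x \<in> convex hull S"
  then obtain T u where "finite T" "T \<subseteq> S" "\<forall>v\<in>T. 0 \<le> u v" "sum u T = 1" "(\<Sum>v\<in>T. u v *\<^sub>R v) = x"
    unfolding convex_hull_explicit by blast
  then have "x \<in> convex hull T" unfolding convex_hull_finite[OF \<open>finite T\<close>] by blast
  then show ?thesis using convex_comb_of_hull[OF \<open>T \<subseteq> S\<close> \<open>finite T\<close>] by (intro exI[of _ "card T"]) simp
qed

text \<open>Supplies the finite bound that gives meaning to the \<open>LEAST\<close> in
  \<open>caratheodory_number\<close>, for sets in the span of a finite \<open>B\<close> inside an
  arbitrary real vector space.\<close>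

lemma finite_dim_caratheodory:
  assumes "finite B" "S \<subseteq> span B" "x \<in> convex hull S"
  shows "convex_comb S (card B + 1) x"
proof -
  obtain T u where T: "finite T" "T \<subseteq> S" "\<forall>v\<in>T. 0 \<le> u v" "sum u T = 1" "(\<Sum>v\<in>T. u v *\<^sub>R v) = x"
    using assms(3) unfolding convex_hull_explicit by blast
  \<comment> \<open>The extra coordinate 1 keeps the total weight fixed when
    \<open>conic_reduction\<close> discards points.\<close>
  let ?\<phi> = "\<lambda>v. (1::real, v)"
  have "\<exists>J w'. J \<subseteq> T \<and> card J \<le> card B + 1 \<and> (\<forall>i\<in>J. 0 \<le> w' i) \<and>
            (\<Sum>i\<in>J. w' i *\<^sub>R ?\<phi> i) = (\<Sum>i\<in>T. u i *\<^sub>R ?\<phi> i)"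
  proof (rule conic_reduction)
    fix J assume J: "J \<subseteq> T" "card B + 1 < card J"
    then have fJ: "finite J" using T(1) finite_subset by blast
    have "\<exists>M. \<forall>v\<in>J. v = (\<Sum>b\<in>B. M b v *\<^sub>R b)"
    proof -
      have "\<exists>m. v = (\<Sum>b\<in>B. m b *\<^sub>R b)" if "v \<in> J" for v
      proof -
        have "v \<in> span B" using that J T assms by blast
        then show ?thesis using span_finite[OF assms(1)] by auto
      qed
      then obtain m where "\<And>v. v \<in> J \<Longrightarrow> v = (\<Sum>b\<in>B. m v b *\<^sub>R b)" by metis
      then show ?thesis by (intro exI[of _ "\<lambda>b v. m v b"]) auto
    qed
    then obtain M where M: "\<And>v. v \<in> J \<Longrightarrow> v = (\<Sum>b\<in>B. M b v *\<^sub>R b)" by blast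
    \<comment> \<open>Row \<open>None\<close> records the extra coordinate, which accounts for the
      \<open>+ 1\<close> in the bound.\<close>
    define M' where "M' = (\<lambda>b. case b of None \<Rightarrow> (\<lambda>_. 1) | Some b \<Rightarrow> M b)"
    have "card (insert None (Some ` B)) < card J"
      using J assms(1) by (simp add: card_image)
    from underdetermined_system[OF _ fJ this, of M'] obtain c where
      c: "\<exists>a\<in>J. c a \<noteq> 0" "(\<Sum>a\<in>J. c a) = 0" "\<And>b. b \<in> B \<Longrightarrow> (\<Sum>a\<in>J. M b a * c a) = 0"
      using assms(1) by (auto simp: M'_def)
    have "(\<Sum>v\<in>J. c v *\<^sub>R v) = (\<Sum>v\<in>J. \<Sum>b\<in>B. (M b v * c v) *\<^sub>R b)"
    proof (intro sum.cong refl)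
      fix v assume "v \<in> J"
      have "c v *\<^sub>R v = c v *\<^sub>R (\<Sum>b\<in>B. M b v *\<^sub>R b)" using M[OF \<open>v \<in> J\<close>] by simp
      then show "c v *\<^sub>R v = (\<Sum>b\<in>B. (M b v * c v) *\<^sub>R b)"
        by (simp add: scaleR_sum_right mult.commute)
    qed
    also have "\<dots> = (\<Sum>b\<in>B. (\<Sum>v\<in>J. M b v * c v) *\<^sub>R b)"
      by (subst sum.swap) (simp add: scaleR_sum_left)
    also have "\<dots> = 0" using c(3) by simp
    finally have "(\<Sum>v\<in>J. c v *\<^sub>R ?\<phi> v) = 0"
      using c(2) by (simp add: sum_prod zero_prod_def)
    then show "\<exists>c. (\<exists>i\<in>J. c i \<noteq> 0) \<and> (\<Sum>v\<in>J. c v *\<^sub>R ?\<phi> v) = 0" using c(1) by blast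
  qed (use T in auto)
  then obtain J w' where J: "J \<subseteq> T" "card J \<le> card B + 1" "\<forall>i\<in>J. 0 \<le> w' i"
    "(\<Sum>i\<in>J. w' i *\<^sub>R ?\<phi> i) = (\<Sum>i\<in>T. u i *\<^sub>R ?\<phi> i)" by blast
  from J(4) have "sum w' J = 1" "(\<Sum>i\<in>J. w' i *\<^sub>R i) = x"
    using T by (auto simp: sum_prod)
  moreover have "finite J" using J T finite_subset by blast
  ultimately have "x \<in> convex hull J" using J(3) unfolding convex_hull_finite[OF \<open>finite J\<close>] by blast
  then show ?thesis using J T \<open>finite J\<close> by (intro convex_comb_of_hull[of J]) auto
qed

section \<open>Affine Veronese varieties\<close>

lemma lookup_scaleR: "Poly_Mapping.lookup (r *\<^sub>R p) i = r * Poly_Mapping.lookup p i"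
  for p :: "'i \<Rightarrow>\<^sub>0 real"
  by (simp add: scaleR_poly_mapping_def)

lemma monomial_vector_in_span:
  "finite E \<Longrightarrow> monomial_vector E x \<in> span ((\<lambda>\<alpha>. Poly_Mapping.single \<alpha> 1) ` E)"
  unfolding monomial_vector_def
proof (rule span_sum)
  fix \<alpha> assume "finite E" "\<alpha> \<in> E"
  have "Poly_Mapping.single \<alpha> (monomial_value \<alpha> x) = monomial_value \<alpha> x *\<^sub>R Poly_Mapping.single \<alpha> 1"
    by (intro poly_mapping_eqI) (auto simp: lookup_scaleR lookup_single when_def)
  then show "Poly_Mapping.single \<alpha> (monomial_value \<alpha> x) \<in> span ((\<lambda>\<alpha>. Poly_Mapping.single \<alpha> 1) ` E)"
    using \<open>\<alpha> \<in> E\<close> by (simp add: span_base span_scale)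
qed

lemma convex_comb_affine_veronese_number:
  assumes "x \<in> convex hull affine_veronese n D"
  shows "convex_comb (affine_veronese n D) (caratheodory_number (affine_veronese n D)) x"
proof (rule convex_comb_caratheodory_number)
  let ?E = "monomials_le n D - {replicate n 0}"
  let ?B = "(\<lambda>\<alpha>. Poly_Mapping.single \<alpha> (1::real)) ` ?E"
  fix x assume "x \<in> convex hull affine_veronese n D"
  moreover have "finite ?B" by (simp add: finite_monomials_le)
  moreover have "affine_veronese n D \<subseteq> span ?B"
    unfolding affine_veronese_def by (auto intro!: monomial_vector_in_span simp: finite_monomials_le)
  ultimately show "convex_comb (affine_veronese n D) (card ?B + 1) x"
    by (intro finite_dim_caratheodory)
qed (fact assms)

text \<open>A truncated moment problem: up to degree \<open>D\<close>, the family \<open>m\<close>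
  consists of the moments of a measure with at most \<open>N\<close> atoms. The constant monomial is
  included and prescribes the total mass.\<close>

definition moment_rep :: "nat \<Rightarrow> nat \<Rightarrow> nat \<Rightarrow> (nat list \<Rightarrow> real) \<Rightarrow> bool" where
  "moment_rep n D N m \<longleftrightarrow>
    (\<exists>w y. (\<forall>i<N. 0 \<le> w i \<and> length (y i) = n) \<and>
       (\<forall>\<alpha>\<in>monomials_le n D. m \<alpha> = (\<Sum>i<N. w i * monomial_value \<alpha> (y i))))"

text \<open>The variety has no coordinate for the constant monomial. Giving it the moment 1 turns
  the normalisation of the weights into one more moment equation.\<close>

definition affine_moment :: "nat \<Rightarrow> (nat list \<Rightarrow>\<^sub>0 real) \<Rightarrow> nat list \<Rightarrow> real" where
  "affine_moment n x \<alpha> = (if \<alpha> = replicate n 0 then 1 else Poly_Mapping.lookup x \<alpha>)"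

lemma monomial_value_replicate_0 [simp]: "monomial_value (replicate n 0) x = 1"
  by (simp add: monomial_value_def)

lemma replicate_0_in_monomials_le [simp]: "replicate n 0 \<in> monomials_le n D"
  by (simp add: monomials_le_def sum_list_replicate)

lemma affine_comb_moment_eqs:
  assumes "(\<Sum>i\<in>I. w i) = 1"
    "x = (\<Sum>i\<in>I. w i *\<^sub>R monomial_vector (monomials_le n D - {replicate n 0}) (y i))"
    "\<alpha> \<in> monomials_le n D"
  shows "affine_moment n x \<alpha> = (\<Sum>i\<in>I. w i * monomial_value \<alpha> (y i))"
  using assms by (auto simp: affine_moment_def lookup_sum lookup_scaleR lookup_monomial_vector finite_monomials_le)

lemma convex_comb_affine_veronese:
  assumes "convex_comb (affine_veronese n D) N x"
  shows "moment_rep n D N (affine_moment n x)"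
proof -
  let ?v = "monomial_vector (monomials_le n D - {replicate n 0})"
  obtain w s where ws: "\<forall>i<N. 0 \<le> w i \<and> s i \<in> affine_veronese n D" "(\<Sum>i<N. w i) = 1"
      "x = (\<Sum>i<N. w i *\<^sub>R s i)"
    using assms by (auto simp: convex_comb_def)
  have "\<forall>i. \<exists>y. i < N \<longrightarrow> length y = n \<and> s i = ?v y"
    using ws(1) by (auto simp: affine_veronese_def image_iff)
  then obtain y where y: "\<And>i. i < N \<Longrightarrow> length (y i) = n \<and> s i = ?v (y i)" by metis
  have x: "x = (\<Sum>i<N. w i *\<^sub>R ?v (y i))" using ws(3) y by simp
  show ?thesis
    unfolding moment_rep_def using affine_comb_moment_eqs[OF ws(2) x] ws(1) y
    by (intro exI[of _ w] exI[of _ y]) auto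
qed

lemma moment_rep_convex_comb:
  assumes "moment_rep n D N (affine_moment n x)"
    and supp: "\<And>\<alpha>. \<alpha> \<notin> monomials_le n D - {replicate n 0} \<Longrightarrow> Poly_Mapping.lookup x \<alpha> = 0"
  shows "convex_comb (affine_veronese n D) N x"
proof -
  let ?E = "monomials_le n D - {replicate n 0}"
  obtain w y where wy: "\<forall>i<N. 0 \<le> w i \<and> length (y i) = n"
    "\<And>\<alpha>. \<alpha> \<in> monomials_le n D \<Longrightarrow> affine_moment n x \<alpha> = (\<Sum>i<N. w i * monomial_value \<alpha> (y i))"
    using assms(1) by (auto simp: moment_rep_def)
  have 1: "(\<Sum>i<N. w i) = 1"
    using wy(2)[of "replicate n 0"] by (simp add: affine_moment_def)
  have 2: "x = (\<Sum>i<N. w i *\<^sub>R monomial_vector ?E (y i))"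
  proof (rule poly_mapping_eqI)
    fix \<alpha>
    show "Poly_Mapping.lookup x \<alpha> = Poly_Mapping.lookup (\<Sum>i<N. w i *\<^sub>R monomial_vector ?E (y i)) \<alpha>"
      using wy(2)[of \<alpha>] supp[of \<alpha>]
      by (cases "\<alpha> \<in> monomials_le n D"; cases "\<alpha> = replicate n 0")
        (auto simp: lookup_sum lookup_scaleR lookup_monomial_vector finite_monomials_le affine_moment_def)
  qed
  show ?thesis
    unfolding convex_comb_def using wy(1) 1 2
    by (intro exI[of _ w] exI[of _ "\<lambda>i. monomial_vector ?E (y i)"]) (auto simp: affine_veronese_def)
qed

text \<open>The ambient space has a coordinate for every exponent list; this supplies the support
  condition under which the moments determine a point.\<close>

lemma affine_veronese_hull_supp:
  assumes "x \<in> convex hull affine_veronese n D" "\<alpha> \<notin> monomials_le n D - {replicate n 0}"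
  shows "Poly_Mapping.lookup x \<alpha> = 0"
proof -
  let ?Z = "{x :: nat list \<Rightarrow>\<^sub>0 real. Poly_Mapping.lookup x \<alpha> = 0}"
  have "convex ?Z" by (auto simp: convex_def lookup_add lookup_scaleR)
  moreover have "affine_veronese n D \<subseteq> ?Z"
    using assms(2) by (auto simp: affine_veronese_def lookup_monomial_vector finite_monomials_le)
  ultimately have "convex hull affine_veronese n D \<subseteq> ?Z" by (rule hull_minimal[rotated])
  then show ?thesis using assms(1) by blast
qed

lemma affine_veronese_hull_moments:
  assumes "finite I" "\<And>i. i \<in> I \<Longrightarrow> 0 \<le> w i" "(\<Sum>i\<in>I. w i) = 1" "\<And>i. i \<in> I \<Longrightarrow> length (y i) = n"
  obtains x where "x \<in> convex hull affine_veronese n D"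
    "\<And>\<alpha>. \<alpha> \<in> monomials_le n D \<Longrightarrow> affine_moment n x \<alpha> = (\<Sum>i\<in>I. w i * monomial_value \<alpha> (y i))"
proof
  let ?x = "\<Sum>i\<in>I. w i *\<^sub>R monomial_vector (monomials_le n D - {replicate n 0}) (y i)"
  show "?x \<in> convex hull affine_veronese n D"
    using assms by (intro convex_sum convex_convex_hull) (auto intro!: hull_inc simp: affine_veronese_def)
  show "affine_moment n ?x \<alpha> = (\<Sum>i\<in>I. w i * monomial_value \<alpha> (y i))" if "\<alpha> \<in> monomials_le n D" for \<alpha>
    using assms(3) refl that by (rule affine_comb_moment_eqs)
qed

lemma caratheodory_affine_veronese_mono:
  assumes "D \<le> D'"
  shows "caratheodory_number (affine_veronese n D) \<le> caratheodory_number (affine_veronese n D')"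
proof (rule caratheodory_number_le)
  fix x assume x: "x \<in> convex hull affine_veronese n D"
  have sub: "monomials_le n D \<subseteq> monomials_le n D'" using assms by (auto simp: monomials_le_def)
  obtain N where "convex_comb (affine_veronese n D) N x" using hull_imp_convex_comb[OF x] by blast
  then obtain w y where wy: "\<forall>i<N. 0 \<le> w i \<and> length (y i) = n"
    "\<And>\<alpha>. \<alpha> \<in> monomials_le n D \<Longrightarrow> affine_moment n x \<alpha> = (\<Sum>i<N. w i * monomial_value \<alpha> (y i))"
    using convex_comb_affine_veronese[of n D N x] by (auto simp: moment_rep_def)
  have 1: "(\<Sum>i<N. w i) = 1" using wy(2)[of "replicate n 0"] by (simp add: affine_moment_def)
  \<comment> \<open>The lift depends on the chosen representation of \<open>x\<close>. Any choice
    will do, because the moments up to degree \<open>D\<close> are those of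
    \<open>x\<close>.\<close>
  obtain x' where x': "x' \<in> convex hull affine_veronese n D'"
    "\<And>\<alpha>. \<alpha> \<in> monomials_le n D' \<Longrightarrow> affine_moment n x' \<alpha> = (\<Sum>i<N. w i * monomial_value \<alpha> (y i))"
    by (rule affine_veronese_hull_moments[OF _ _ 1, of y n D']) (use wy(1) in auto)
  let ?N = "caratheodory_number (affine_veronese n D')"
  have "moment_rep n D' ?N (affine_moment n x')"
    by (intro convex_comb_affine_veronese convex_comb_affine_veronese_number x'(1))
  moreover have "affine_moment n x \<alpha> = affine_moment n x' \<alpha>" if "\<alpha> \<in> monomials_le n D" for \<alpha>
    using that wy(2) x'(2) sub by auto
  ultimately have "moment_rep n D ?N (affine_moment n x)"
    using sub unfolding moment_rep_def by (metis subsetD)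
  then show "convex_comb (affine_veronese n D) ?N x"
    by (rule moment_rep_convex_comb) (use affine_veronese_hull_supp[OF x] in auto)
qed

section \<open>Multiplying and dividing monomials by one variable\<close>

lemma sum_list_raise:
  "a < length \<alpha> \<Longrightarrow> sum_list (\<alpha>[a := Suc (\<alpha> ! a)]) = Suc (sum_list (\<alpha> :: nat list))"
  by (simp add: sum_list_update)

lemma prod_raise:
  fixes z :: "nat \<Rightarrow> real"
  assumes "a < length \<alpha>"
  shows "(\<Prod>i<length \<alpha>. z i ^ (\<alpha>[a := Suc (\<alpha> ! a)] ! i)) = z a * (\<Prod>i<length \<alpha>. z i ^ (\<alpha> ! i))"
proof -
  have "(\<Prod>i\<in>{..<length \<alpha>} - {a}. z i ^ (\<alpha>[a := Suc (\<alpha> ! a)] ! i)) =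
      (\<Prod>i\<in>{..<length \<alpha>} - {a}. z i ^ (\<alpha> ! i))"
    by (rule prod.cong) auto
  then show ?thesis
    using assms by (simp add: prod.remove[of "{..<length \<alpha>}" a])
qed

lemma monomial_value_raise:
  "a < length \<alpha> \<Longrightarrow> monomial_value (\<alpha>[a := Suc (\<alpha> ! a)]) x = x ! a * monomial_value \<alpha> x"
  unfolding monomial_value_def using prod_raise[of a \<alpha> "\<lambda>i. x ! i"] by simp

lemma exponent_lower:
  assumes "sum_list \<alpha> \<noteq> (0::nat)"
  obtains a \<beta> where "a < length \<alpha>" "length \<beta> = length \<alpha>" "\<alpha> = \<beta>[a := Suc (\<beta> ! a)]"
    "sum_list \<alpha> = Suc (sum_list \<beta>)"
proof -
  obtain a where a: "a < length \<alpha>" "\<alpha> ! a \<noteq> 0"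
    using assms by (auto simp: in_set_conv_nth)
  let ?\<beta> = "\<alpha>[a := \<alpha> ! a - 1]"
  have "\<alpha> = ?\<beta>[a := Suc (?\<beta> ! a)]" using a by simp
  then show ?thesis using that[of a ?\<beta>] a sum_list_raise[of a ?\<beta>] by simp
qed

lemma sum_list_0_replicate: "sum_list \<alpha> = (0::nat) \<longleftrightarrow> \<alpha> = replicate (length \<alpha>) 0"
proof
  assume "sum_list \<alpha> = 0"
  then show "\<alpha> = replicate (length \<alpha>) 0" by (intro replicate_eqI) auto
next
  assume "\<alpha> = replicate (length \<alpha>) 0"
  then have "sum_list \<alpha> = sum_list (replicate (length \<alpha>) 0)" by (rule arg_cong)
  then show "sum_list \<alpha> = 0" by (simp only: sum_list_replicate mult_0_right)
qed

lemma exponent_lower_le: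
  assumes "\<alpha> \<in> monomials_le n D" "\<alpha> \<noteq> replicate n 0"
  obtains a D' \<beta> where "a < n" "D = Suc D'" "\<beta> \<in> monomials_le n D'"
    "\<forall>x. monomial_value \<alpha> x = x ! a * monomial_value \<beta> x"
proof -
  have \<alpha>: "length \<alpha> = n" "sum_list \<alpha> \<le> D" using assms by (auto simp: monomials_le_def)
  then have "sum_list \<alpha> \<noteq> 0" using assms(2) sum_list_0_replicate by blast
  then obtain a \<beta> where ab: "a < length \<alpha>" "length \<beta> = length \<alpha>" "\<alpha> = \<beta>[a := Suc (\<beta> ! a)]"
    "sum_list \<alpha> = Suc (sum_list \<beta>)" by (rule exponent_lower)
  have a: "a < n" "a < length \<beta>" using ab(1,2) \<alpha>(1) by linarith+
  have D: "D = Suc (D - 1)" using ab(4) \<alpha>(2) by linarith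
  have "length \<beta> = n" "sum_list \<beta> \<le> D - 1" using ab(2,4) \<alpha> by linarith+
  then have \<beta>: "\<beta> \<in> monomials_le n (D - 1)" by (simp only: monomials_le_def mem_Collect_eq simp_thms)
  have "\<forall>x. monomial_value \<alpha> x = x ! a * monomial_value \<beta> x"
    using monomial_value_raise[OF a(2)] unfolding ab(3)[symmetric] by (rule allI)
  then show ?thesis by (rule that[OF a(1) D \<beta>])
qed

text \<open>Reduces the comparison of two measures up to degree two to their masses, means and
  second moments.\<close>

lemma quadratic_monomial_cases:
  assumes "\<alpha> \<in> monomials_le n 2"
  shows "(\<forall>x. monomial_value \<alpha> x = 1) \<or> (\<exists>a<n. \<forall>x. monomial_value \<alpha> x = x ! a) \<or>
    (\<exists>a<n. \<exists>b<n. \<forall>x. monomial_value \<alpha> x = x ! a * x ! b)"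
proof (cases "\<alpha> = replicate n 0")
  case False
  with assms obtain a \<beta> D' where 1: "a < n" "2 = Suc D'" "\<beta> \<in> monomials_le n D'"
    "\<forall>x. monomial_value \<alpha> x = x ! a * monomial_value \<beta> x" by (rule exponent_lower_le)
  show ?thesis
  proof (cases "\<beta> = replicate n 0")
    case True
    then show ?thesis using 1 by auto
  next
    case False
    with 1(3) obtain b \<gamma> D'' where 2: "b < n" "D' = Suc D''" "\<gamma> \<in> monomials_le n D''"
      "\<forall>x. monomial_value \<beta> x = x ! b * monomial_value \<gamma> x" by (rule exponent_lower_le)
    have "length \<gamma> = n" "sum_list \<gamma> = 0" using 1(2) 2(2,3) by (simp_all add: monomials_le_def)
    then have "\<gamma> = replicate n 0" by (simp only: sum_list_0_replicate)
    then have "\<forall>x. monomial_value \<alpha> x = x ! a * x ! b" using 1(4) 2(4) by simp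
    then show ?thesis using 1(1) 2(1) by blast
  qed
qed simp

lemma linear_monomial:
  assumes "a < n" "\<beta> \<in> monomials_le n D"
  obtains \<alpha> where "\<alpha> \<in> monomials_le n (Suc D)" "\<And>x. monomial_value \<alpha> x = x ! a * monomial_value \<beta> x"
proof
  show "\<beta>[a := Suc (\<beta> ! a)] \<in> monomials_le n (Suc D)"
    using assms by (simp add: monomials_le_def sum_list_raise)
  show "monomial_value (\<beta>[a := Suc (\<beta> ! a)]) x = x ! a * monomial_value \<beta> x" for x
    by (rule monomial_value_raise) (use assms in \<open>simp add: monomials_le_def\<close>)
qed

section \<open>Moments of degree two\<close>

text \<open>Splitting an atom \<open>v\<close> of weight \<open>p\<close> into \<open>v \<plusminus> u / sqrt p\<close> adds \<open>u u\<^sup>T\<close> to the covariance.\<close>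

lemma atoms_with_covariance:
  fixes \<mu> :: "nat \<Rightarrow> real" and u :: "'j \<Rightarrow> nat \<Rightarrow> real"
  assumes "finite J"
  shows "\<exists>w y. (\<forall>i\<le>card J. 0 < w i \<and> length (y i) = n) \<and> (\<Sum>i\<le>card J. w i) = 1 \<and>
    (\<forall>a<n. (\<Sum>i\<le>card J. w i * y i ! a) = \<mu> a) \<and>
    (\<forall>a<n. \<forall>b<n. (\<Sum>i\<le>card J. w i * (y i ! a * y i ! b)) = \<mu> a * \<mu> b + (\<Sum>j\<in>J. u j a * u j b))"
  using assms
proof (induction J rule: finite_induct)
  case empty
  show ?case by (intro exI[of _ "\<lambda>_. 1"] exI[of _ "\<lambda>_. map \<mu> [0..<n]"]) simp
next
  case (insert j J)
  define l where "l = card J"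
  obtain w y where wy: "\<And>i. i \<le> l \<Longrightarrow> 0 < w i \<and> length (y i) = n" "(\<Sum>i\<le>l. w i) = (1::real)"
    "\<And>a. a < n \<Longrightarrow> (\<Sum>i\<le>l. w i * y i ! a) = \<mu> a"
    "\<And>a b. a < n \<Longrightarrow> b < n \<Longrightarrow>
      (\<Sum>i\<le>l. w i * (y i ! a * y i ! b)) = \<mu> a * \<mu> b + (\<Sum>j\<in>J. u j a * u j b)"
    using insert.IH unfolding l_def by blast
  \<comment> \<open>The last atom is the one to be split. Strict positivity of the weights is part
    of the induction because of the division by \<open>sqrt p\<close>.\<close>
  define p where "p = w l"
  have p: "p > 0" using wy(1)[of l] by (simp add: p_def)
  define z where "z = (\<lambda>s. map (\<lambda>a. y l ! a + s * u j a / sqrt p) [0..<n])"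
  define w' where "w' = w(l := p / 2, Suc l := p / 2)"
  define y' where "y' = y(l := z 1, Suc l := z (- 1))"
  have c: "card (insert j J) = Suc l" using insert.hyps by (simp add: l_def)
  have sum': "(\<Sum>i\<le>Suc l. w' i * f (y' i)) = (\<Sum>i\<le>l. w i * f (y i)) - p * f (y l) + p / 2 * (f (z 1) + f (z (- 1)))"
    for f :: "real list \<Rightarrow> real"
  proof -
    have "(\<Sum>i<l. w' i * f (y' i)) = (\<Sum>i<l. w i * f (y i))"
      by (rule sum.cong) (auto simp: w'_def y'_def)
    then show ?thesis
      by (simp add: lessThan_Suc_atMost[symmetric] w'_def y'_def p_def algebra_simps)
  qed
  have "(\<Sum>i\<le>Suc l. w' i) = 1" using sum'[of "\<lambda>_. 1"] wy(2) by simp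
  moreover have "\<forall>i\<le>Suc l. 0 < w' i \<and> length (y' i) = n"
    using p wy(1) by (auto simp: w'_def y'_def z_def)
  moreover have "(\<Sum>i\<le>Suc l. w' i * y' i ! a) = \<mu> a" if "a < n" for a
    using sum'[of "\<lambda>x. x ! a"] wy(3) that by (simp add: z_def)
  moreover have "(\<Sum>i\<le>Suc l. w' i * (y' i ! a * y' i ! b)) = \<mu> a * \<mu> b + (\<Sum>j\<in>insert j J. u j a * u j b)"
    if "a < n" "b < n" for a b
  proof -
    \<comment> \<open>The terms linear in \<open>u\<close> cancel between the two new atoms.\<close>
    have "p / 2 * (z 1 ! a * z 1 ! b + z (- 1) ! a * z (- 1) ! b)
        = p * (y l ! a * y l ! b) + p * (u j a / sqrt p) * (u j b / sqrt p)"
      using that by (simp add: z_def algebra_simps)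
    also have "p * (u j a / sqrt p) * (u j b / sqrt p) = u j a * u j b"
      using p by simp
    finally show ?thesis
      using sum'[of "\<lambda>x. x ! a * x ! b"] wy(4)[OF that] sum.insert[OF insert.hyps, of "\<lambda>j. u j a * u j b"]
      by linarith
  qed
  ultimately show ?case unfolding c
    by (intro exI[of _ w'] exI[of _ y'] conjI allI impI) auto
qed

lemma caratheodory_affine_veronese_2_le: "caratheodory_number (affine_veronese n 2) \<le> n + 1"
proof (rule caratheodory_number_le)
  fix x assume x: "x \<in> convex hull affine_veronese n 2"
  obtain N where "convex_comb (affine_veronese n 2) N x" using hull_imp_convex_comb[OF x] by blast
  then obtain w y where wy: "\<forall>i<N. 0 \<le> w i \<and> length (y i) = n"
    "\<And>\<alpha>. \<alpha> \<in> monomials_le n 2 \<Longrightarrow> affine_moment n x \<alpha> = (\<Sum>i<N. w i * monomial_value \<alpha> (y i))"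
    using convex_comb_affine_veronese[of n 2 N x] by (auto simp: moment_rep_def)
  have w1: "(\<Sum>i<N. w i) = 1" using wy(2)[of "replicate n 0"] by (simp add: affine_moment_def)
  define \<mu> where "\<mu> = (\<lambda>a. \<Sum>i<N. w i * y i ! a)"
  \<comment> \<open>The covariance matrix. Its quadratic form at \<open>c\<close> is the variance of
    the linear function with coefficients \<open>c\<close>, hence nonnegative.\<close>
  define B where "B = (\<lambda>a b. \<Sum>i<N. w i * ((y i ! a - \<mu> a) * (y i ! b - \<mu> b)))"
  have Beq: "(\<Sum>i<N. w i * (y i ! a * y i ! b)) = \<mu> a * \<mu> b + B a b" for a b
  proof -
    have "B a b = (\<Sum>i<N. w i * (y i ! a * y i ! b)) - (\<Sum>i<N. w i * y i ! a) * \<mu> b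
        - \<mu> a * (\<Sum>i<N. w i * y i ! b) + (\<Sum>i<N. w i) * (\<mu> a * \<mu> b)"
      unfolding B_def sum_distrib_left sum_distrib_right sum_subtractf[symmetric] sum.distrib[symmetric]
      by (rule sum.cong) (simp_all add: algebra_simps)
    moreover have "(\<Sum>i<N. w i * y i ! c) = \<mu> c" for c by (simp add: \<mu>_def)
    ultimately show ?thesis using w1 by simp
  qed
  have "\<exists>u. \<forall>a\<in>{..<n}. \<forall>b\<in>{..<n}. B a b = (\<Sum>j\<in>{..<n}. u j a * u j b)"
  proof (rule psd_sum_of_squares)
    show "B a b = B b a" for a b by (simp add: B_def mult.commute)
    show "0 \<le> (\<Sum>a<n. \<Sum>b<n. c a * c b * B a b)" for c
    proof -
      have "(\<Sum>a<n. \<Sum>b<n. c a * c b * B a b)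
          = (\<Sum>a<n. \<Sum>b<n. \<Sum>i<N. w i * ((c a * (y i ! a - \<mu> a)) * (c b * (y i ! b - \<mu> b))))"
        by (simp add: B_def sum_distrib_left algebra_simps)
      also have "\<dots> = (\<Sum>a<n. \<Sum>i<N. \<Sum>b<n. w i * ((c a * (y i ! a - \<mu> a)) * (c b * (y i ! b - \<mu> b))))"
        by (intro sum.cong refl sum.swap)
      also have "\<dots> = (\<Sum>i<N. \<Sum>a<n. \<Sum>b<n. w i * ((c a * (y i ! a - \<mu> a)) * (c b * (y i ! b - \<mu> b))))"
        by (rule sum.swap)
      also have "\<dots> = (\<Sum>i<N. w i * (\<Sum>a<n. c a * (y i ! a - \<mu> a))\<^sup>2)"
        unfolding power2_eq_square sum_product by (simp only: sum_distrib_left)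
      also have "\<dots> \<ge> 0" using wy(1) by (intro sum_nonneg) auto
      finally show ?thesis .
    qed
  qed simp
  then obtain u where u: "\<And>a b. a < n \<Longrightarrow> b < n \<Longrightarrow> B a b = (\<Sum>j<n. u j a * u j b)" by auto
  obtain w' y' where wy': "\<And>i. i \<le> n \<Longrightarrow> 0 < w' i \<and> length (y' i) = n" "(\<Sum>i\<le>n. w' i) = (1::real)"
    "\<And>a. a < n \<Longrightarrow> (\<Sum>i\<le>n. w' i * y' i ! a) = \<mu> a"
    "\<And>a b. a < n \<Longrightarrow> b < n \<Longrightarrow>
      (\<Sum>i\<le>n. w' i * (y' i ! a * y' i ! b)) = \<mu> a * \<mu> b + (\<Sum>j<n. u j a * u j b)"
    using atoms_with_covariance[of "{..<n}" n \<mu> u] unfolding card_lessThan by blast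
  have eq: "(\<Sum>i<N. w i * monomial_value \<alpha> (y i)) = (\<Sum>i\<le>n. w' i * monomial_value \<alpha> (y' i))"
    if "\<alpha> \<in> monomials_le n 2" for \<alpha>
    using quadratic_monomial_cases[OF that]
  proof (elim disjE exE conjE)
    fix a assume "a < n" "\<forall>x. monomial_value \<alpha> x = x ! a"
    then show ?thesis using wy'(3) by (simp add: \<mu>_def)
  next
    fix a b assume "a < n" "b < n" "\<forall>x. monomial_value \<alpha> x = x ! a * x ! b"
    then show ?thesis using wy'(4) u Beq by simp
  qed (use w1 wy'(2) in simp)
  have "moment_rep n 2 (n + 1) (affine_moment n x)"
    unfolding moment_rep_def using wy(2) wy'(1) eq
    by (intro exI[of _ w'] exI[of _ y']) (auto simp: lessThan_Suc_atMost less_eq_real_def)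
  then show "convex_comb (affine_veronese n 2) (n + 1) x"
    by (rule moment_rep_convex_comb) (use affine_veronese_hull_supp[OF x] in auto)
qed

text \<open>With fewer than \<open>n + 1\<close> atoms the square of some affine function integrates to 0; it does not for
  the uniform measure on the vertices of the standard simplex.\<close>

lemma caratheodory_affine_veronese_2_ge: "n + 1 \<le> caratheodory_number (affine_veronese n 2)"
proof (rule ccontr)
  define \<kappa> where "\<kappa> = caratheodory_number (affine_veronese n 2)"
  assume "\<not> n + 1 \<le> caratheodory_number (affine_veronese n 2)"
  then have \<kappa>: "\<kappa> < n + 1" by (simp add: \<kappa>_def)
  \<comment> \<open>For \<open>i = n\<close> no entry equals 1, so \<open>e n\<close> is the origin
    and \<open>e 0\<close>, ..., \<open>e n\<close> are the vertices of the simplex.\<close>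
  define e :: "nat \<Rightarrow> real list" where "e = (\<lambda>i. map (\<lambda>a. if a = i then 1 else 0) [0..<n])"
  obtain x where x: "x \<in> convex hull affine_veronese n 2"
    "\<And>\<alpha>. \<alpha> \<in> monomials_le n 2 \<Longrightarrow>
      affine_moment n x \<alpha> = (\<Sum>i\<le>n. 1 / (n + 1) * monomial_value \<alpha> (e i))"
    by (rule affine_veronese_hull_moments[of "{..n}" "\<lambda>_. 1 / (n + 1)" e n 2]) (auto simp: e_def)
  have "moment_rep n 2 \<kappa> (affine_moment n x)"
    unfolding \<kappa>_def by (intro convex_comb_affine_veronese convex_comb_affine_veronese_number x)
  then obtain w y where wy: "\<forall>i<\<kappa>. 0 \<le> w i \<and> length (y i) = n"
    "\<And>\<alpha>. \<alpha> \<in> monomials_le n 2 \<Longrightarrow> affine_moment n x \<alpha> = (\<Sum>i<\<kappa>. w i * monomial_value \<alpha> (y i))"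
    by (auto simp: moment_rep_def)
  \<comment> \<open>A basis of the affine functions: the coordinates, and the constant 1 at index
    \<open>n\<close>. Its \<open>n + 1\<close> coefficients face at most \<open>n\<close> atoms, so
    some nonzero affine function vanishes at all of them.\<close>
  define h where "h = (\<lambda>a (z :: real list). if a = n then 1 else z ! a)"
  obtain c where c: "\<exists>a\<in>{..n}. c a \<noteq> 0" "\<And>t. t < \<kappa> \<Longrightarrow> (\<Sum>a\<le>n. h a (y t) * c a) = 0"
    using underdetermined_system[of "{..<\<kappa>}" "{..n}" "\<lambda>t a. h a (y t)"] \<kappa> by auto
  have mom: "(\<Sum>i<\<kappa>. w i * (h a (y i) * h b (y i))) = (\<Sum>i\<le>n. 1 / (n + 1) * (h a (e i) * h b (e i)))"
    if "a \<le> n" "b \<le> n" for a b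
  proof -
    have lin: "\<exists>\<alpha>\<in>monomials_le n 1. \<forall>z. monomial_value \<alpha> z = h a z" if "a \<le> n" for a
    proof (cases "a = n")
      case False
      then have "a < n" using that by simp
      obtain \<alpha> where "\<alpha> \<in> monomials_le n (Suc 0)" "\<And>x. monomial_value \<alpha> x = x ! a * monomial_value (replicate n 0) x"
        by (rule linear_monomial[OF \<open>a < n\<close>, of "replicate n 0" 0]) auto
      then show ?thesis using False by (auto simp: h_def)
    qed (auto simp: h_def intro!: bexI[of _ "replicate n 0"])
    obtain \<beta> where \<beta>: "\<beta> \<in> monomials_le n 1" "\<forall>z. monomial_value \<beta> z = h b z"
      using lin[OF \<open>b \<le> n\<close>] by (elim bexE)
    have "\<exists>\<alpha>\<in>monomials_le n 2. \<forall>z. monomial_value \<alpha> z = h a z * h b z"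
    proof (cases "a = n")
      case True
      then show ?thesis using \<beta> by (intro bexI[of _ \<beta>]) (auto simp: h_def monomials_le_def)
    next
      case False
      then have "a < n" using that by simp
      obtain \<alpha> where "\<alpha> \<in> monomials_le n (Suc 1)" "\<And>x. monomial_value \<alpha> x = x ! a * monomial_value \<beta> x"
        by (rule linear_monomial[OF \<open>a < n\<close> \<beta>(1)]) auto
      then show ?thesis using False \<beta>(2)
        by (intro bexI[of _ \<alpha>]) (simp_all add: h_def numeral_2_eq_2)
    qed
    then obtain \<alpha> where "\<alpha> \<in> monomials_le n 2" "\<forall>z. monomial_value \<alpha> z = h a z * h b z" by (elim bexE)
    with x(2)[of \<alpha>] wy(2)[of \<alpha>] show ?thesis by (simp only:)
  qed
  define f where "f = (\<lambda>z. \<Sum>a\<le>n. h a z * c a)"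
  have sq: "(\<Sum>i\<in>I. v i * (f (z i))\<^sup>2) = (\<Sum>a\<le>n. \<Sum>b\<le>n. c a * c b * (\<Sum>i\<in>I. v i * (h a (z i) * h b (z i))))"
    for I :: "nat set" and v z
  proof -
    have "(\<Sum>i\<in>I. v i * (f (z i))\<^sup>2)
        = (\<Sum>i\<in>I. \<Sum>a\<le>n. \<Sum>b\<le>n. c a * c b * (v i * (h a (z i) * h b (z i))))"
      unfolding f_def power2_eq_square sum_product by (simp add: sum_distrib_left ac_simps)
    also have "\<dots> = (\<Sum>a\<le>n. \<Sum>i\<in>I. \<Sum>b\<le>n. c a * c b * (v i * (h a (z i) * h b (z i))))"
      by (rule sum.swap)
    also have "\<dots> = (\<Sum>a\<le>n. \<Sum>b\<le>n. \<Sum>i\<in>I. c a * c b * (v i * (h a (z i) * h b (z i))))"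
      by (intro sum.cong refl sum.swap)
    finally show ?thesis by (simp add: sum_distrib_left)
  qed
  have "(\<Sum>i\<le>n. 1 / (n + 1) * (f (e i))\<^sup>2) = (\<Sum>i<\<kappa>. w i * (f (y i))\<^sup>2)"
    unfolding sq by (intro sum.cong refl) (simp only: mom atMost_iff)
  also have "\<dots> = 0" using c(2) by (simp add: f_def)
  finally have "\<forall>i\<in>{..n}. 1 / (n + 1) * (f (e i))\<^sup>2 = 0"
    by (subst (asm) sum_nonneg_eq_0_iff) auto
  then have f0: "f (e i) = 0" if "i \<le> n" for i using that by (simp add: add_eq_0_iff_both_eq_0)
  \<comment> \<open>The vertex values determine an affine function: the origin gives the constant
    term, and \<open>e i\<close> then gives the coefficient \<open>c i\<close>.\<close>
  have fe: "f (e i) = c n + (if i < n then c i else 0)" if "i \<le> n" for i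
  proof -
    have "f (e i) = c n + (\<Sum>a<n. h a (e i) * c a)"
      by (simp add: f_def lessThan_Suc_atMost[symmetric] h_def)
    also have "(\<Sum>a<n. h a (e i) * c a) = (\<Sum>a<n. if a = i then c a else 0)"
      by (rule sum.cong) (auto simp: h_def e_def)
    finally show ?thesis by simp
  qed
  have "c n = 0" using f0[of n] fe[of n] by simp
  then have "c a = 0" if "a \<le> n" for a using f0[OF that] fe[OF that] that by (cases "a = n") auto
  then show False using c(1) by auto
qed

section \<open>The lower bound from a complete intersection grid\<close>

text \<open>The standard monomials of the grid: representatives of polynomials modulo the products
  of \<open>x_i - g\<close> over \<open>g < k\<close>, one product for each
  \<open>i\<close>.\<close>

definition exponent_box :: "nat \<Rightarrow> nat \<Rightarrow> nat list set" where
  "exponent_box n k = {\<alpha>. length \<alpha> = n \<and> set \<alpha> \<subseteq> {..<k}}"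

definition point_grid :: "nat \<Rightarrow> nat \<Rightarrow> real list set" where
  "point_grid n k = {y. length y = n \<and> set y \<subseteq> real ` {..<k}}"

lemma finite_exponent_box: "finite (exponent_box n k)"
  unfolding exponent_box_def using finite_lists_length_eq[of "{..<k}" n] by (simp add: conj_commute)

lemma finite_point_grid: "finite (point_grid n k)"
  unfolding point_grid_def using finite_lists_length_eq[of "real ` {..<k}" n] by (simp add: conj_commute)

lemma exponent_box_Suc:
  "exponent_box (Suc n) k = (\<lambda>(a, \<beta>). a # \<beta>) ` ({..<k} \<times> exponent_box n k)"
  by (auto simp: exponent_box_def length_Suc_conv image_iff)

lemma monomial_value_Cons: "monomial_value (a # \<beta>) (t # y) = t ^ a * monomial_value \<beta> y"
  unfolding monomial_value_def by (simp add: prod.lessThan_Suc_shift del: prod.lessThan_Suc)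

lemma coeffs_zero_of_many_roots:
  fixes C :: "nat \<Rightarrow> real"
  assumes "\<And>t. t \<in> S \<Longrightarrow> (\<Sum>a<k. t ^ a * C a) = 0" "finite S" "k \<le> card S" "a < k"
  shows "C a = 0"
proof -
  define p where "p = (\<Sum>a<k. monom (C a) a)"
  have coeff: "coeff p i = (if i < k then C i else 0)" for i
    by (simp add: p_def coeff_sum)
  have "p = 0"
  proof (rule ccontr)
    assume "p \<noteq> 0"
    have "poly p t = 0" if "t \<in> S" for t
      using assms(1)[OF that] by (simp add: p_def poly_sum poly_monom mult.commute)
    then have "S \<subseteq> {t. poly p t = 0}" by blast
    then have "card S \<le> card {t. poly p t = 0}"
      using poly_roots_finite[OF \<open>p \<noteq> 0\<close>] by (rule card_mono[rotated])
    also have "\<dots> \<le> degree p" by (rule card_poly_roots_bound[OF \<open>p \<noteq> 0\<close>])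
    also have "\<dots> < k"
      using coeff[of "degree p"] \<open>p \<noteq> 0\<close> by (metis leading_coeff_0_iff)
    finally show False using assms(3) by simp
  qed
  then show ?thesis using coeff[of a] assms(4) by simp
qed

text \<open>With the other variables fixed at a grid point, the polynomial has degree below
  \<open>k\<close> in the first variable and vanishes at \<open>k\<close> values. So each
  coefficient, a polynomial in the remaining variables, vanishes on their grid.\<close>

lemma exponent_box_independent:
  assumes "\<And>y. y \<in> point_grid n k \<Longrightarrow> (\<Sum>\<alpha>\<in>exponent_box n k. monomial_value \<alpha> y * c \<alpha>) = 0"
    and "\<alpha> \<in> exponent_box n k"
  shows "c \<alpha> = 0"
  using assms
proof (induction n arbitrary: c \<alpha>)
  case 0
  have box: "exponent_box 0 k = {[]}" by (auto simp: exponent_box_def)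
  have "[] \<in> point_grid 0 k" by (simp add: point_grid_def)
  from 0(1)[OF this] 0(2) show ?case unfolding box by (simp add: monomial_value_def)
next
  case (Suc n)
  obtain a \<beta> where ab: "a < k" "\<beta> \<in> exponent_box n k" "\<alpha> = a # \<beta>"
    using Suc.prems(2) by (auto simp: exponent_box_Suc)
  have "(\<Sum>\<beta>\<in>exponent_box n k. monomial_value \<beta> y * c (a # \<beta>)) = 0" if y: "y \<in> point_grid n k" for y
  proof (rule coeffs_zero_of_many_roots[where S = "real ` {..<k}" and k = k and a = a and
        C = "\<lambda>a. \<Sum>\<beta>\<in>exponent_box n k. monomial_value \<beta> y * c (a # \<beta>)"])
    fix t assume t: "t \<in> real ` {..<k}"
    have inj: "inj_on (\<lambda>(a, \<beta>). a # \<beta>) ({..<k} \<times> exponent_box n k)" by (auto simp: inj_on_def)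
    have "t # y \<in> point_grid (Suc n) k" using t y by (auto simp: point_grid_def)
    from Suc.prems(1)[OF this]
    have "(\<Sum>(a, \<beta>)\<in>{..<k} \<times> exponent_box n k. t ^ a * (monomial_value \<beta> y * c (a # \<beta>))) = 0"
      unfolding exponent_box_Suc sum.reindex[OF inj]
      by (simp add: case_prod_unfold monomial_value_Cons mult.assoc)
    then show "(\<Sum>a<k. t ^ a * (\<Sum>\<beta>\<in>exponent_box n k. monomial_value \<beta> y * c (a # \<beta>))) = 0"
      by (simp add: sum.cartesian_product[symmetric] sum_distrib_left)
  qed (use ab in \<open>auto simp: card_image\<close>)
  then show ?case unfolding ab(3) by (intro Suc.IH[of "\<lambda>\<beta>. c (a # \<beta>)"] ab(2))
qed

lemma monomial_value_power:
  assumes "i < n"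
  shows "monomial_value ((replicate n 0)[i := j]) y = y ! i ^ j"
proof -
  have "monomial_value ((replicate n 0)[i := j]) y = (\<Prod>l<n. if l = i then y ! i ^ j else 1)"
    unfolding monomial_value_def by (rule prod.cong) (auto simp: nth_list_update)
  then show ?thesis using assms by simp
qed

text \<open>If fewer atoms sufficed, they would lie on the grid, and some nonzero \<open>q T\<close>
  would vanish at all of them and so integrate to 0. The measure is built to exclude this: there are
  only finitely many candidate supports \<open>T\<close>, and \<open>q T\<close> is fixed for each
  of them before the weights are chosen.\<close>

lemma caratheodory_affine_veronese_ge_card:
  assumes "k \<ge> 1"
  shows "card (exponent_box n k \<inter> monomials_le n (2 * k)) \<le> caratheodory_number (affine_veronese n (2 * k))"
proof (rule ccontr)
  define A where "A = exponent_box n k \<inter> monomials_le n (2 * k)"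
  define G where "G = point_grid n k"
  define \<kappa> where "\<kappa> = caratheodory_number (affine_veronese n (2 * k))"
  assume "\<not> ?thesis"
  then have \<kappa>: "\<kappa> < card A" by (simp add: A_def \<kappa>_def)
  have fA: "finite A" by (simp add: A_def finite_exponent_box)
  have fG: "finite G" by (simp add: G_def finite_point_grid)
  \<comment> \<open>Numbers the grid points; the point \<open>y\<close> will get a weight
    proportional to \<open>t ^ h y\<close>.\<close>
  obtain h where h: "bij_betw h G {..<card G}"
    using fG by (metis ex_bij_betw_finite_nat atLeast0LessThan)
  have inj: "inj_on h G" using h by (simp add: bij_betw_def)
  define \<T> where "\<T> = {T. T \<subseteq> G \<and> card T \<le> \<kappa>}"
  have f\<T>: "finite \<T>" unfolding \<T>_def using fG by simp
  have "\<forall>T. \<exists>c. T \<in> \<T> \<longrightarrow> (\<exists>a\<in>A. c a \<noteq> 0) \<and> (\<forall>y\<in>T. (\<Sum>a\<in>A. monomial_value a y * c a) = 0)"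
  proof
    fix T
    show "\<exists>c. T \<in> \<T> \<longrightarrow> (\<exists>a\<in>A. c a \<noteq> 0) \<and> (\<forall>y\<in>T. (\<Sum>a\<in>A. monomial_value a y * c a) = 0)"
    proof (cases "T \<in> \<T>")
      case True
      then have "finite T" "card T < card A" using fG \<kappa> finite_subset by (auto simp: \<T>_def)
      then show ?thesis using underdetermined_system[of T A "\<lambda>y a. monomial_value a y"] fA by blast
    qed simp
  qed
  from choice[OF this] obtain c where c:
    "\<forall>T. T \<in> \<T> \<longrightarrow> (\<exists>a\<in>A. c T a \<noteq> 0) \<and> (\<forall>y\<in>T. (\<Sum>a\<in>A. monomial_value a y * c T a) = 0)" ..
  define q where "q = (\<lambda>T y. \<Sum>a\<in>A. monomial_value a y * c T a)"
  have q_zero: "q T y = 0" if "T \<in> \<T>" "y \<in> T" for T y using c that by (simp add: q_def)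
  \<comment> \<open>\<open>q T\<close> cannot vanish on the whole grid, because its monomials are
    independent there.\<close>
  have q_nonzero: "\<exists>y\<in>G. q T y \<noteq> 0" if T: "T \<in> \<T>" for T
  proof (rule ccontr)
    assume neg: "\<not> ?thesis"
    obtain a where a: "a \<in> A" "c T a \<noteq> 0" using c T by blast
    have "(if a \<in> A then c T a else 0) = 0"
    proof (rule exponent_box_independent[of n k "\<lambda>a. if a \<in> A then c T a else 0"])
      fix y assume "y \<in> point_grid n k"
      then have "q T y = 0" using neg by (simp add: G_def)
      moreover have "q T y = (\<Sum>\<alpha>\<in>exponent_box n k. monomial_value \<alpha> y * (if \<alpha> \<in> A then c T \<alpha> else 0))"
        unfolding q_def by (rule sum.mono_neutral_cong_left) (auto simp: A_def finite_exponent_box)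
      ultimately show "(\<Sum>\<alpha>\<in>exponent_box n k. monomial_value \<alpha> y * (if \<alpha> \<in> A then c T \<alpha> else 0)) = 0"
        by simp
    qed (use a in \<open>simp add: A_def\<close>)
    then show False using a by simp
  qed
  \<comment> \<open>Up to the factor \<open>Z\<close>, the integral of \<open>q T\<close> as a
    polynomial in \<open>t\<close>. Different grid points contribute to different powers, so the
    coefficients are the values of \<open>q T\<close> on the grid and \<open>R T\<close> is
    nonzero.\<close>
  define R where "R = (\<lambda>T. \<Sum>y\<in>G. monom (q T y) (h y))"
  have R: "R T \<noteq> 0" if T: "T \<in> \<T>" for T
  proof -
    obtain y where y: "y \<in> G" "q T y \<noteq> 0" using q_nonzero[OF T] by blast
    have "coeff (R T) (h y) = (\<Sum>z\<in>G. if z = y then q T z else 0)"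
      unfolding R_def coeff_sum using inj y(1) by (intro sum.cong) (auto simp: inj_on_def)
    also have "\<dots> = q T y" using y(1) fG by simp
    finally show ?thesis using y(2) by auto
  qed
  \<comment> \<open>Finitely many nonzero polynomials have finitely many roots, so some positive
    \<open>t\<close> avoids them all.\<close>
  define Bad where "Bad = (\<Union>T\<in>\<T>. {t. poly (R T) t = 0})"
  have "finite Bad" unfolding Bad_def using f\<T> poly_roots_finite[OF R] by (rule finite_UN_I)
  then have "infinite ({0<..} - Bad)" using infinite_Ioi by (rule Diff_infinite_finite)
  then have "{0<..} - Bad \<noteq> {}" by (rule infinite_imp_nonempty)
  then obtain t where "t \<in> {0<..} - Bad" by (elim ex_in_conv[THEN iffD2, THEN exE])
  then have t: "t > 0" "\<And>T. T \<in> \<T> \<Longrightarrow> poly (R T) t \<noteq> 0"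
    unfolding Bad_def by simp_all
  define Z where "Z = (\<Sum>y\<in>G. t ^ h y)"
  \<comment> \<open>The hypothesis \<open>k >= 1\<close> puts the origin on the grid, so the total
    weight is positive.\<close>
  have "replicate n 0 \<in> G" using assms by (force simp: G_def point_grid_def)
  then have "Z > 0" unfolding Z_def using t(1) fG by (intro sum_pos) auto
  have len: "length y = n" if "y \<in> G" for y using that by (simp add: G_def point_grid_def)
  have wsum: "(\<Sum>y\<in>G. t ^ h y / Z) = 1"
    using \<open>Z > 0\<close> by (simp add: sum_divide_distrib[symmetric] Z_def)
  have wpos: "0 \<le> t ^ h y / Z" if "y \<in> G" for y using t(1) \<open>Z > 0\<close> by simp
  obtain x where x: "x \<in> convex hull affine_veronese n (2 * k)"
    "\<And>\<alpha>. \<alpha> \<in> monomials_le n (2 * k) \<Longrightarrow> affine_moment n x \<alpha> = (\<Sum>y\<in>G. t ^ h y / Z * monomial_value \<alpha> y)"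
    by (rule affine_veronese_hull_moments[where y = "\<lambda>y. y" and D = "2 * k", OF fG wpos wsum len]) (assumption | rule that)+
  have "moment_rep n (2 * k) \<kappa> (affine_moment n x)"
    unfolding \<kappa>_def by (intro convex_comb_affine_veronese convex_comb_affine_veronese_number x)
  then obtain w y where wy: "\<And>l. l < \<kappa> \<Longrightarrow> 0 \<le> w l \<and> length (y l) = n"
    "\<And>\<alpha>. \<alpha> \<in> monomials_le n (2 * k) \<Longrightarrow> affine_moment n x \<alpha> = (\<Sum>l<\<kappa>. w l * monomial_value \<alpha> (y l))"
    unfolding moment_rep_def by blast
  have mom: "(\<Sum>l<\<kappa>. w l * monomial_value \<alpha> (y l)) = (\<Sum>y\<in>G. t ^ h y / Z * monomial_value \<alpha> y)"
    if "\<alpha> \<in> monomials_le n (2 * k)" for \<alpha> using x(2)[OF that] wy(2)[OF that] by simp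
  \<comment> \<open>The square has degree at most \<open>2 * k\<close>, so the moments fix its
    integral in each coordinate, and this is 0 for the grid measure. As the square is nonnegative
    and vanishes only at the integers from 0 to k - 1, every atom of positive weight lies on the
    grid.\<close>
  define P where "P = (\<Prod>g<k. [:- real g, 1:])\<^sup>2"
  have polyP: "poly P s = (\<Prod>g<k. s - real g)\<^sup>2" for s by (simp add: P_def poly_prod)
  have "degree (\<Prod>g<k. [:- real g, 1:]) = k" by (simp add: degree_prod_eq_sum_degree)
  then have degP: "degree P \<le> 2 * k" unfolding P_def
    by (metis degree_power_le mult.commute)
  have P_mom: "(\<Sum>l<\<kappa>. w l * poly P (y l ! i)) = 0" if i: "i < n" for i
  proof -
    have expand: "(\<Sum>l\<in>I. v l * poly P (z l ! i)) = (\<Sum>j\<le>degree P. coeff P j * (\<Sum>l\<in>I. v l * z l ! i ^ j))"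
      for I :: "'b set" and v z
      by (simp add: poly_altdef sum_distrib_left, subst sum.swap) (simp add: ac_simps)
    have "(\<Sum>l<\<kappa>. w l * poly P (y l ! i)) = (\<Sum>y\<in>G. t ^ h y / Z * poly P (y ! i))"
      unfolding expand
    proof (intro sum.cong refl, goal_cases)
      case (1 j)
      then have "(replicate n 0)[i := j] \<in> monomials_le n (2 * k)"
        using degP i by (simp add: monomials_le_def sum_list_update sum_list_replicate)
      from mom[OF this] show ?case by (simp add: monomial_value_power[OF i])
    qed
    also have "\<dots> = 0"
    proof (rule sum.neutral, rule ballI)
      fix y assume "y \<in> G"
      then have "y ! i \<in> real ` {..<k}" using i by (auto simp: G_def point_grid_def)
      then show "t ^ h y / Z * poly P (y ! i) = 0" by (auto simp: polyP)
    qed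
    finally show ?thesis .
  qed
  have in_grid: "y l \<in> G" if l: "l < \<kappa>" "w l \<noteq> 0" for l
  proof -
    have "y l ! i \<in> real ` {..<k}" if "i < n" for i
    proof -
      have "\<forall>l\<in>{..<\<kappa>}. w l * poly P (y l ! i) = 0"
        using P_mom[OF that] wy(1) by (subst (asm) sum_nonneg_eq_0_iff) (auto simp: polyP)
      then have "poly P (y l ! i) = 0" using l by auto
      then show ?thesis by (auto simp: polyP)
    qed
    then show ?thesis using wy(1)[OF l(1)] by (auto simp: G_def point_grid_def in_set_conv_nth)
  qed
  \<comment> \<open>Atoms of weight 0 are dropped, since nothing forces them onto the grid.\<close>
  define T where "T = y ` {l\<in>{..<\<kappa>}. w l \<noteq> 0}"
  have "card T \<le> card {l\<in>{..<\<kappa>}. w l \<noteq> 0}" unfolding T_def by (rule card_image_le) simp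
  also have "\<dots> \<le> card {..<\<kappa>}" by (rule card_mono) auto
  also have "\<dots> = \<kappa>" by simp
  finally have T: "T \<in> \<T>" using in_grid by (auto simp: \<T>_def T_def)
  have expand: "(\<Sum>l\<in>I. v l * q T (z l)) = (\<Sum>a\<in>A. c T a * (\<Sum>l\<in>I. v l * monomial_value a (z l)))"
    for I :: "'b set" and v z
    by (simp add: q_def sum_distrib_left, subst sum.swap) (simp add: ac_simps)
  have "0 = (\<Sum>l<\<kappa>. w l * q T (y l))"
    using q_zero[OF T] by (intro sum.neutral[symmetric]) (auto simp: T_def)
  also have "\<dots> = (\<Sum>y\<in>G. t ^ h y / Z * q T y)"
    unfolding expand by (intro sum.cong refl arg_cong2[where f = "(*)"] mom) (simp add: A_def)
  also have "\<dots> = poly (R T) t / Z"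
    by (simp add: R_def poly_sum poly_monom sum_divide_distrib mult.commute)
  finally show False using t(2)[OF T] \<open>Z > 0\<close> by simp
qed

section \<open>Counting the monomials with a large exponent\<close>

lemma card_exponent_ge:
  assumes "i < n"
  shows "card {\<alpha> \<in> monomials_le n (2 * k). k \<le> \<alpha> ! i} = (n + k) choose n"
proof -
  \<comment> \<open>Multiplication by the \<open>k\<close>-th power of variable \<open>i\<close>:
    what remains after dividing it out has degree at most \<open>2 * k - k = k\<close>.\<close>
  have "bij_betw (\<lambda>\<alpha>. \<alpha>[i := \<alpha> ! i + k]) (monomials_le n k) {\<alpha> \<in> monomials_le n (2 * k). k \<le> \<alpha> ! i}"
  proof (rule bij_betw_byWitness[where f' = "\<lambda>\<alpha>. \<alpha>[i := \<alpha> ! i - k]"])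
    show "(\<lambda>\<alpha>. \<alpha>[i := \<alpha> ! i - k]) ` {\<alpha> \<in> monomials_le n (2 * k). k \<le> \<alpha> ! i} \<subseteq> monomials_le n k"
    proof clarify
      fix \<alpha> assume \<alpha>: "\<alpha> \<in> monomials_le n (2 * k)" "k \<le> \<alpha> ! i"
      then have "i < length \<alpha>" using assms by (simp add: monomials_le_def)
      then have "\<alpha> ! i \<le> sum_list \<alpha>" by (rule elem_le_sum_list)
      moreover have "sum_list (\<alpha>[i := \<alpha> ! i - k]) = sum_list \<alpha> + (\<alpha> ! i - k) - \<alpha> ! i"
        using \<open>i < length \<alpha>\<close> by (rule sum_list_update)
      ultimately show "\<alpha>[i := \<alpha> ! i - k] \<in> monomials_le n k"
        using \<alpha> by (auto simp: monomials_le_def)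
    qed
  qed (use assms in \<open>auto simp: monomials_le_def sum_list_update\<close>)
  from bij_betw_same_card[OF this] show ?thesis by (simp add: card_monomials_le)
qed

text \<open>A Bonferroni count: the exponents \<open>k e\<^sub>i + k e\<^sub>r\<close> lie in two of the sets.\<close>

lemma card_large_exponents:
  assumes "k \<ge> 1" "r \<le> n"
  shows "card (\<Union>i<r. {\<alpha> \<in> monomials_le n (2 * k). k \<le> \<alpha> ! i}) + (r choose 2) \<le> r * ((n + k) choose n)"
  using assms(2)
proof (induction r)
  case (Suc r)
  define A where "A = (\<lambda>i. {\<alpha> \<in> monomials_le n (2 * k). k \<le> \<alpha> ! i})"
  define U where "U = (\<Union>i<r. A i)"
  have fin: "finite U" "finite (A r)" by (auto simp: U_def A_def finite_monomials_le)
  define g where "g = (\<lambda>i. (replicate n 0)[i := k, r := k])"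
  have "inj_on g {..<r}"
  proof (rule inj_onI)
    fix i j assume ij: "i \<in> {..<r}" "j \<in> {..<r}" "g i = g j"
    then have "g i ! i = g j ! i" by simp
    then show "i = j" using ij Suc.prems assms(1) by (auto simp: g_def nth_list_update split: if_splits)
  qed
  moreover have "g ` {..<r} \<subseteq> U \<inter> A r"
  proof
    fix \<alpha> assume "\<alpha> \<in> g ` {..<r}"
    then obtain i where i: "i < r" "\<alpha> = g i" by auto
    then have "sum_list \<alpha> = 2 * k" "length \<alpha> = n"
      using Suc.prems by (auto simp: g_def sum_list_update)
    moreover have "\<alpha> ! i = k" "\<alpha> ! r = k" using i Suc.prems by (auto simp: g_def)
    ultimately show "\<alpha> \<in> U \<inter> A r" using i by (auto simp: U_def A_def monomials_le_def)
  qed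
  \<comment> \<open>These \<open>r\<close> common elements provide the growth of the binomial
    coefficient from \<open>r choose 2\<close> to \<open>Suc r choose 2\<close>.\<close>
  ultimately have "r \<le> card (U \<inter> A r)"
    using fin by (metis card_lessThan card_inj_on_le finite_Int)
  moreover have "card (U \<union> A r) + card (U \<inter> A r) = card U + card (A r)"
    using card_Un_Int[OF fin] by simp
  moreover have "card U + (r choose 2) \<le> r * ((n + k) choose n)"
    unfolding U_def A_def using Suc by simp
  moreover have "card (A r) = (n + k) choose n"
    unfolding A_def using Suc.prems by (intro card_exponent_ge) simp
  moreover have "(\<Union>i<Suc r. A i) = U \<union> A r" by (auto simp: U_def lessThan_Suc)
  moreover have "Suc r choose 2 = (r choose 2) + r" by (simp add: numeral_2_eq_2)
  ultimately show ?case unfolding A_def[symmetric] by simp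
qed simp

text \<open>Stated over the integers because the difference of the first two terms can be negative.
  An exponent list of sum at most \<open>2 * k\<close> has at most two entries that reach
  \<open>k\<close>, so the Bonferroni count loses nothing.\<close>

lemma caratheodory_affine_veronese_ge:
  assumes "k \<ge> 1"
  shows "int ((2 * k + n) choose n) - int n * int ((k + n) choose n) + int (n choose 2)
    \<le> int (caratheodory_number (affine_veronese n (2 * k)))"
proof -
  define U where "U = (\<Union>i<n. {\<alpha> \<in> monomials_le n (2 * k). k \<le> \<alpha> ! i})"
  have sub: "U \<subseteq> monomials_le n (2 * k)" by (auto simp: U_def)
  have "\<alpha> \<in> exponent_box n k \<longleftrightarrow> \<alpha> \<notin> U" if "\<alpha> \<in> monomials_le n (2 * k)" for \<alpha>
  proof -
    have "length \<alpha> = n" using that by (simp add: monomials_le_def)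
    moreover have "set \<alpha> \<subseteq> {..<k} \<longleftrightarrow> (\<forall>i<length \<alpha>. \<alpha> ! i < k)"
      by (auto simp: set_conv_nth)
    ultimately show ?thesis
      using that by (auto simp: exponent_box_def U_def not_le)
  qed
  then have "exponent_box n k \<inter> monomials_le n (2 * k) = monomials_le n (2 * k) - U" by blast
  then have "card (exponent_box n k \<inter> monomials_le n (2 * k)) + card U = card (monomials_le n (2 * k))"
    using card_Diff_subset[OF finite_subset[OF sub finite_monomials_le] sub]
      card_mono[OF finite_monomials_le sub] by simp
  moreover have "card U + (n choose 2) \<le> n * ((n + k) choose n)"
    unfolding U_def using assms by (rule card_large_exponents) simp
  ultimately have "((n + 2 * k) choose n) + (n choose 2)
      \<le> caratheodory_number (affine_veronese n (2 * k)) + n * ((n + k) choose n)"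
    using caratheodory_affine_veronese_ge_card[OF assms, of n] by (simp add: card_monomials_le)
  then have "int ((n + 2 * k) choose n) + int (n choose 2)
      \<le> int (caratheodory_number (affine_veronese n (2 * k))) + int n * int ((n + k) choose n)"
    by (metis of_nat_add of_nat_le_iff of_nat_mult)
  then show ?thesis by (simp add: add.commute)
qed

section \<open>Forms\<close>

definition form_monomial :: "nat list \<Rightarrow> (nat \<Rightarrow> real) \<Rightarrow> real" where
  "form_monomial \<alpha> x = (\<Prod>i<length \<alpha>. x i ^ (\<alpha> ! i))"

text \<open>Homogeneous polynomials as functions on sequences, of which only the first
  \<open>r\<close> entries enter. Building them by multiplication with one variable at a time gives
  an induction that serves derivatives, restriction to lines and coefficients alike.\<close>

inductive form :: "nat \<Rightarrow> nat \<Rightarrow> ((nat \<Rightarrow> real) \<Rightarrow> real) \<Rightarrow> bool" for r where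
  const: "form r 0 (\<lambda>_. c)"
| zero: "form r d (\<lambda>_. 0)"
| var: "i < r \<Longrightarrow> form r d f \<Longrightarrow> form r (Suc d) (\<lambda>x. x i * f x)"
| add: "form r d f \<Longrightarrow> form r d g \<Longrightarrow> form r d (\<lambda>x. f x + g x)"

lemma form_scale: "form r d f \<Longrightarrow> form r d (\<lambda>x. c * f x)"
proof (induction rule: form.induct)
  case (var i d f)
  have "(\<lambda>x. c * (x i * f x)) = (\<lambda>x. x i * (c * f x))" by (simp add: mult.left_commute)
  then show ?case using form.var[OF var.hyps(1) var.IH] by simp
qed (auto simp: distrib_left intro: form.intros)

lemma form_sum: "(\<And>i. i \<in> I \<Longrightarrow> form r d (f i)) \<Longrightarrow> form r d (\<lambda>x. \<Sum>i\<in>I. f i x)"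
  by (induction I rule: infinite_finite_induct) (auto intro: form.intros)

lemma form_linear: "form r (Suc 0) (\<lambda>x. \<Sum>j<r. b j * x j)"
proof (rule form_sum)
  fix j assume "j \<in> {..<r}"
  then have "form r (Suc 0) (\<lambda>x. x j * b j)" by (intro form.intros) auto
  then show "form r (Suc 0) (\<lambda>x. b j * x j)" by (simp only: mult.commute)
qed

lemma form_var_power: "i < r \<Longrightarrow> form r d f \<Longrightarrow> form r (e + d) (\<lambda>x. x i ^ e * f x)"
proof (induction e)
  case (Suc e)
  then have "form r (Suc (e + d)) (\<lambda>x. x i * (x i ^ e * f x))" by (intro form.var)
  then show ?case by (simp add: mult.assoc)
qed simp

lemma form_form_monomial:
  assumes "length \<alpha> = r"
  shows "form r (sum_list \<alpha>) (form_monomial \<alpha>)"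
  using assms
proof (induction "sum_list \<alpha>" arbitrary: \<alpha>)
  case 0
  then have "\<alpha> = replicate r 0" using sum_list_0_replicate[of \<alpha>] by simp
  then have "form_monomial \<alpha> = (\<lambda>_. 1)" by (auto simp: form_monomial_def intro!: prod.neutral)
  moreover have "form r (sum_list \<alpha>) (\<lambda>_. 1)" unfolding 0(1)[symmetric] by (rule form.const)
  ultimately show ?case by simp
next
  case (Suc d)
  then have "sum_list \<alpha> \<noteq> 0" by linarith
  then obtain a \<beta> where ab: "a < length \<alpha>" "length \<beta> = length \<alpha>" "\<alpha> = \<beta>[a := Suc (\<beta> ! a)]"
    "sum_list \<alpha> = Suc (sum_list \<beta>)" by (rule exponent_lower)
  have \<beta>: "d = sum_list \<beta>" "length \<beta> = r" "a < r" "a < length \<beta>"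
    using ab(1,2,4) Suc(2,3) by linarith+
  have "form_monomial (\<beta>[a := Suc (\<beta> ! a)]) x = x a * form_monomial \<beta> x" for x
    using prod_raise[OF \<beta>(4), of x] by (simp add: form_monomial_def)
  then have "form_monomial \<alpha> = (\<lambda>x. x a * form_monomial \<beta> x)"
    unfolding ab(3)[symmetric] by blast
  moreover have "form r (Suc (sum_list \<beta>)) (\<lambda>x. x a * form_monomial \<beta> x)"
    by (intro form.var \<beta> Suc(1)[OF \<beta>(1)])
  ultimately show ?case using ab(4) by simp
qed

text \<open>Passes from functions to coefficient vectors, where dimensions are counted by
  \<open>card (monomials_eq r d)\<close>.\<close>

lemma form_coeffs:
  assumes "form r d f"
  shows "\<exists>c. \<forall>x. f x = (\<Sum>\<alpha>\<in>monomials_eq r d. c \<alpha> * form_monomial \<alpha> x)"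
  using assms
proof (induction rule: form.induct)
  case (const c)
  have "monomials_eq r 0 = {replicate r 0}"
    using sum_list_0_replicate by (auto simp: monomials_eq_def sum_list_replicate)
  then show ?case by (intro exI[of _ "\<lambda>_. c"]) (simp add: form_monomial_def)
next
  case (zero d)
  show ?case by (intro exI[of _ "\<lambda>_. 0"]) simp
next
  case (var i d f)
  then obtain c where c: "\<And>x. f x = (\<Sum>\<alpha>\<in>monomials_eq r d. c \<alpha> * form_monomial \<alpha> x)" by blast
  define up where "up = (\<lambda>\<alpha> :: nat list. \<alpha>[i := Suc (\<alpha> ! i)])"
  define down where "down = (\<lambda>\<alpha> :: nat list. \<alpha>[i := \<alpha> ! i - 1])"
  have len: "i < length \<alpha>" if "\<alpha> \<in> monomials_eq r d" for \<alpha>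
    using that var.hyps(1) by (simp add: monomials_eq_def)
  have down_up: "down (up \<alpha>) = \<alpha>" if "\<alpha> \<in> monomials_eq r d" for \<alpha>
    using len[OF that] by (simp add: up_def down_def)
  have inj: "inj_on up (monomials_eq r d)" by (rule inj_on_inverseI) (rule down_up)
  have sub: "up ` monomials_eq r d \<subseteq> monomials_eq r (Suc d)"
    using var.hyps(1) by (auto simp: up_def monomials_eq_def sum_list_raise)
  \<comment> \<open>A monomial not divisible by variable \<open>i\<close> gets coefficient 0; on the
    others \<open>down\<close> divides by that variable.\<close>
  define c' where "c' = (\<lambda>\<gamma>. if \<gamma> \<in> up ` monomials_eq r d then c (down \<gamma>) else 0)"
  have "x i * f x = (\<Sum>\<gamma>\<in>monomials_eq r (Suc d). c' \<gamma> * form_monomial \<gamma> x)" for x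
  proof -
    have m: "form_monomial (up \<alpha>) x = x i * form_monomial \<alpha> x" if "\<alpha> \<in> monomials_eq r d" for \<alpha>
      using prod_raise[OF len[OF that], of x] by (simp add: form_monomial_def up_def)
    have "(\<Sum>\<gamma>\<in>monomials_eq r (Suc d). c' \<gamma> * form_monomial \<gamma> x)
        = (\<Sum>\<gamma>\<in>up ` monomials_eq r d. c' \<gamma> * form_monomial \<gamma> x)"
      by (rule sum.mono_neutral_right[OF finite_monomials_eq sub]) (simp add: c'_def)
    also have "\<dots> = (\<Sum>\<alpha>\<in>monomials_eq r d. c' (up \<alpha>) * form_monomial (up \<alpha>) x)"
      by (simp add: sum.reindex[OF inj])
    also have "\<dots> = (\<Sum>\<alpha>\<in>monomials_eq r d. x i * (c \<alpha> * form_monomial \<alpha> x))"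
      by (rule sum.cong) (simp_all add: c'_def down_up m)
    finally show ?thesis by (simp add: c sum_distrib_left)
  qed
  then show ?case by blast
next
  case (add d f g)
  then obtain c c' where "\<And>x. f x = (\<Sum>\<alpha>\<in>monomials_eq r d. c \<alpha> * form_monomial \<alpha> x)"
    "\<And>x. g x = (\<Sum>\<alpha>\<in>monomials_eq r d. c' \<alpha> * form_monomial \<alpha> x)" by blast
  then show ?case
    by (intro exI[of _ "\<lambda>\<alpha>. c \<alpha> + c' \<alpha>"]) (simp add: distrib_right sum.distrib)
qed

section \<open>Restriction of forms to lines, and partial derivatives\<close>

lemma form_line:
  "form r d f \<Longrightarrow> \<exists>P. \<forall>t. f (\<lambda>i. a i + t * h i) = poly P t"
proof (induction rule: form.induct)
  case (var i d f)
  then obtain P where "\<And>t. f (\<lambda>i. a i + t * h i) = poly P t" by blast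
  then show ?case by (intro exI[of _ "[:a i, h i:] * P"]) (simp add: algebra_simps)
next
  case (add d f g)
  then obtain P Q where "\<And>t. f (\<lambda>i. a i + t * h i) = poly P t" "\<And>t. g (\<lambda>i. a i + t * h i) = poly Q t"
    by blast
  then show ?case by (intro exI[of _ "P + Q"]) simp
next
  case (const c)
  show ?case by (intro exI[of _ "[:c:]"]) simp
next
  case (zero d)
  show ?case by (intro exI[of _ 0]) simp
qed

text \<open>On the line through \<open>a\<close> and \<open>b\<close> both factors restrict to
  nonzero polynomials in one variable, whose product is nonzero. As forms are plain functions here,
  this is what allows common factors to be cancelled.\<close>

lemma form_mult_nonzero:
  assumes "form r d f" "form r e g" "f a \<noteq> 0" "g b \<noteq> 0"
  shows "\<exists>x. f x * g x \<noteq> 0"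
proof -
  obtain P where P: "\<And>t. f (\<lambda>i. a i + t * (b i - a i)) = poly P t"
    using form_line[OF assms(1), of a "\<lambda>i. b i - a i"] by blast
  obtain Q where Q: "\<And>t. g (\<lambda>i. a i + t * (b i - a i)) = poly Q t"
    using form_line[OF assms(2), of a "\<lambda>i. b i - a i"] by blast
  have "poly P 0 \<noteq> 0" "poly Q 1 \<noteq> 0" using P[of 0] Q[of 1] assms(3,4) by auto
  then have "P * Q \<noteq> 0" by auto
  then obtain t where "poly (P * Q) t \<noteq> 0" using poly_all_0_iff_0 by blast
  then show ?thesis using P[of t] Q[of t] by (metis poly_mult)
qed

text \<open>Partial derivatives by the Leibniz rule, with the chain rule stated along lines, where
  one-variable calculus applies. In degree 0 the truncated \<open>d - 1\<close> would only say that
  they are constants; the induction has to know that they are zero.\<close>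

lemma form_partials:
  assumes "form r d f"
  shows "\<exists>g. (\<forall>i. if d = 0 then g i = (\<lambda>_. 0) else form r (d - 1) (g i)) \<and>
    (\<forall>a h t. ((\<lambda>t. f (\<lambda>i. a i + t * h i)) has_real_derivative
       (\<Sum>i<r. h i * g i (\<lambda>i. a i + t * h i))) (at t))"
  using assms
proof (induction rule: form.induct)
  case (const c)
  show ?case by (intro exI[of _ "\<lambda>_ _. 0"]) auto
next
  case (zero d)
  show ?case by (intro exI[of _ "\<lambda>_ _. 0"]) (auto intro: form.zero)
next
  case (var j d f)
  then obtain g where g: "\<And>i. if d = 0 then g i = (\<lambda>_. 0) else form r (d - 1) (g i)"
    "\<And>a h t. ((\<lambda>t. f (\<lambda>i. a i + t * h i)) has_real_derivative
       (\<Sum>i<r. h i * g i (\<lambda>i. a i + t * h i))) (at t)" by blast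
  define g' where "g' = (\<lambda>i x. (if i = j then f x else 0) + x j * g i x)"
  have "form r d (g' i)" for i
  proof -
    have "form r d (\<lambda>x. if i = j then f x else 0)"
      using var.hyps(2) form.zero by (cases "i = j") auto
    moreover have "form r d (\<lambda>x. x j * g i x)"
    proof (cases "d = 0")
      case True
      then show ?thesis using g(1)[of i] form.zero by simp
    next
      case False
      then have "form r (Suc (d - 1)) (\<lambda>x. x j * g i x)"
        using g(1)[of i] var.hyps(1) by (intro form.var) auto
      then show ?thesis using False by simp
    qed
    ultimately show ?thesis unfolding g'_def by (rule form.add)
  qed
  moreover have "((\<lambda>t. (a j + t * h j) * f (\<lambda>i. a i + t * h i)) has_real_derivative
       (\<Sum>i<r. h i * g' i (\<lambda>i. a i + t * h i))) (at t)" for a h t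
  proof -
    let ?x = "\<lambda>i. a i + t * h i"
    have "(\<Sum>i<r. h i * g' i ?x) = (\<Sum>i<r. (if i = j then h i * f ?x else 0) + (a j + t * h j) * (h i * g i ?x))"
      by (rule sum.cong) (auto simp: g'_def algebra_simps)
    also have "\<dots> = h j * f ?x + (a j + t * h j) * (\<Sum>i<r. h i * g i ?x)"
      using var.hyps(1) by (simp add: sum.distrib sum_distrib_left)
    finally have eq: "(\<Sum>i<r. h i * g' i ?x) = h j * f ?x + (a j + t * h j) * (\<Sum>i<r. h i * g i ?x)" .
    have "((\<lambda>t. a j + t * h j) has_real_derivative h j) (at t)"
      by (auto intro!: derivative_eq_intros)
    from DERIV_mult[OF this g(2)[of a h t]] show ?thesis unfolding eq
      by (simp add: mult.commute add.commute)
  qed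
  ultimately show ?case by (intro exI[of _ g']) simp
next
  case (add d f1 f2)
  then obtain g1 g2 where g1: "\<And>i. if d = 0 then g1 i = (\<lambda>_. 0) else form r (d - 1) (g1 i)"
    "\<And>a h t. ((\<lambda>t. f1 (\<lambda>i. a i + t * h i)) has_real_derivative
       (\<Sum>i<r. h i * g1 i (\<lambda>i. a i + t * h i))) (at t)"
    and g2: "\<And>i. if d = 0 then g2 i = (\<lambda>_. 0) else form r (d - 1) (g2 i)"
    "\<And>a h t. ((\<lambda>t. f2 (\<lambda>i. a i + t * h i)) has_real_derivative
       (\<Sum>i<r. h i * g2 i (\<lambda>i. a i + t * h i))) (at t)" by blast
  have "if d = 0 then (\<lambda>x. g1 i x + g2 i x) = (\<lambda>_. 0) else form r (d - 1) (\<lambda>x. g1 i x + g2 i x)" for i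
    using g1(1)[of i] g2(1)[of i] by (auto intro: form.add)
  moreover have "((\<lambda>t. f1 (\<lambda>i. a i + t * h i) + f2 (\<lambda>i. a i + t * h i)) has_real_derivative
       (\<Sum>i<r. h i * (g1 i (\<lambda>i. a i + t * h i) + g2 i (\<lambda>i. a i + t * h i)))) (at t)" for a h t
    using DERIV_add[OF g1(2)[of a h t] g2(2)[of a h t]] by (simp add: distrib_left sum.distrib)
  ultimately show ?case by (intro exI[of _ "\<lambda>i x. g1 i x + g2 i x"] conjI allI)
qed

lemma form_homogeneous: "form r d f \<Longrightarrow> f (\<lambda>i. s * x i) = s ^ d * f x"
  by (induction rule: form.induct) (auto simp: algebra_simps)

section \<open>Forms vanishing on the zeros of a nonnegative form\<close>

definition indep2 :: "((nat \<Rightarrow> real) \<Rightarrow> real) \<Rightarrow> ((nat \<Rightarrow> real) \<Rightarrow> real) \<Rightarrow> bool" where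
  "indep2 f g \<longleftrightarrow> (\<forall>c1 c2. (\<forall>x. c1 * f x + c2 * g x = 0) \<longrightarrow> c1 = 0 \<and> c2 = 0)"

text \<open>If the gradient of \<open>p\<close> spans only one direction, then \<open>p\<close> is a constant times a power of a
  linear form.\<close>

lemma nonneg_form_vanishing_pair:
  assumes r: "2 \<le> r" and d: "3 \<le> d" and p: "form r d p" "\<And>x. 0 \<le> p x" and nz: "p x0 \<noteq> 0"
  shows "\<exists>w1 w2. form r (d - 1) w1 \<and> form r (d - 1) w2 \<and> indep2 w1 w2 \<and>
    (\<forall>x. p x = 0 \<longrightarrow> w1 x = 0 \<and> w2 x = 0)"
proof -
  obtain g where g: "\<And>i. form r (d - 1) (g i)"
    "\<And>a h t. ((\<lambda>t. p (\<lambda>i. a i + t * h i)) has_real_derivative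
       (\<Sum>i<r. h i * g i (\<lambda>i. a i + t * h i))) (at t)"
    using form_partials[OF p(1)] d by auto
  \<comment> \<open>A zero of the nonnegative \<open>p\<close> is a minimum along every coordinate
    line.\<close>
  have sing: "g i x = 0" if "p x = 0" "i < r" for x i
  proof -
    let ?h = "\<lambda>j. if j = i then 1 else 0 :: real"
    have "((\<lambda>t. p (\<lambda>j. x j + t * ?h j)) has_real_derivative g i x) (at 0)"
      using g(2)[of x ?h 0] that(2) by (simp add: if_distrib[of "\<lambda>z. z * _"] cong: if_cong)
    then show ?thesis
    proof (rule DERIV_local_min[where d = 1])
      show "\<forall>y. \<bar>0 - y\<bar> < 1 \<longrightarrow> p (\<lambda>j. x j + 0 * ?h j) \<le> p (\<lambda>j. x j + y * ?h j)"
        using p(2) that(1) by simp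
    qed simp
  qed
  show ?thesis
  proof (cases "\<exists>i<r. \<exists>j<r. indep2 (g i) (g j)")
    case True
    then obtain i j where "i < r" "j < r" "indep2 (g i) (g j)" by blast
    then show ?thesis using g(1) sing by (intro exI[of _ "g i"] exI[of _ "g j"]) simp
  next
    case False
    have line_const: "p (\<lambda>i. a i + h i) = p a" if "\<And>x. (\<Sum>i<r. h i * g i x) = 0" for a h
    proof -
      have "\<forall>t. ((\<lambda>t. p (\<lambda>i. a i + t * h i)) has_real_derivative 0) (at t)"
        using g(2)[of a h] that by simp
      from DERIV_isconst_all[OF this, of 1 0] show ?thesis by simp
    qed
    have p0: "p (\<lambda>_. 0) = 0" using form_homogeneous[OF p(1), of 0 "\<lambda>_. 0"] d by (simp add: power_0_left)
    have "\<exists>i<r. \<exists>x. g i x \<noteq> 0"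
    proof (rule ccontr)
      assume "\<not> ?thesis"
      then have "(\<Sum>i<r. x0 i * g i x) = 0" for x by simp
      from line_const[OF this, of "\<lambda>_. 0"] show False using nz p0 by simp
    qed
    then obtain i0 y0 where i0: "i0 < r" "g i0 y0 \<noteq> 0" by blast
    have "\<exists>b. \<forall>x. g j x = b * g i0 x" if "j < r" for j
    proof -
      have "\<not> indep2 (g i0) (g j)" using False i0(1) that by blast
      then obtain c1 c2 where c: "\<forall>x. c1 * g i0 x + c2 * g j x = 0" "\<not> (c1 = 0 \<and> c2 = 0)"
        unfolding indep2_def by blast
      have "c2 \<noteq> 0" using spec[OF c(1), of y0] c(2) i0(2) by auto
      then have "g j x = - c1 / c2 * g i0 x" for x using spec[OF c(1), of x] by (simp add: field_simps)
      then show ?thesis by blast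
    qed
    then obtain b where b: "\<And>j x. j < r \<Longrightarrow> g j x = b j * g i0 x" by metis
    have "b i0 = 1" using b[OF i0(1), of y0] i0(2) by simp
    define bb where "bb = (\<Sum>i<r. b i * b i)"
    have "bb > 0" unfolding bb_def using i0(1) \<open>b i0 = 1\<close> by (intro sum_pos2[of _ i0]) auto
    define l where "l = (\<lambda>x. \<Sum>i<r. b i * x i)"
    \<comment> \<open>\<open>x\<close> and its projection \<open>s b\<close> onto the line of
      \<open>b\<close> differ by a vector orthogonal to \<open>b\<close>. Every gradient is a
      multiple of \<open>b\<close>, so \<open>p\<close> is constant in that direction, and
      homogeneity evaluates it at \<open>s b\<close>.\<close>
    have p_l: "p x = (l x / bb) ^ d * p b" for x
    proof -
      define s where "s = l x / bb"
      have "(\<Sum>i<r. (s * b i - x i) * g i y) = 0" for y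
      proof -
        have "(\<Sum>i<r. (s * b i - x i) * g i y) = (\<Sum>i<r. (s * (b i * b i) - b i * x i) * g i0 y)"
          by (rule sum.cong) (auto simp: b algebra_simps)
        also have "\<dots> = (s * bb - l x) * g i0 y"
          by (simp add: sum_distrib_right[symmetric] sum_subtractf sum_distrib_left[symmetric] bb_def l_def)
        also have "\<dots> = 0" using \<open>bb > 0\<close> by (simp add: s_def)
        finally show ?thesis .
      qed
      from line_const[OF this, of x] have "p x = p (\<lambda>i. s * b i)" by simp
      then show ?thesis using form_homogeneous[OF p(1), of s b] by (simp add: s_def)
    qed
    then have "p b \<noteq> 0" using nz by (metis mult_zero_right)
    then have l0: "l x = 0" if "p x = 0" for x using p_l[of x] that \<open>bb > 0\<close> by simp
    have fl: "form r (Suc 0) l" unfolding l_def by (rule form_linear)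
    have "l b \<noteq> 0" using \<open>bb > 0\<close> by (simp add: l_def bb_def)
    \<comment> \<open>The degree is \<open>d - 2\<close>, so that multiplying by \<open>x 0\<close>
      and by \<open>x 1\<close> gives two forms of degree \<open>d - 1\<close>. Here
      \<open>3 <= d\<close> leaves room for the factor \<open>l\<close> and \<open>2 <= r\<close>
      for two variables.\<close>
    define v where "v = (\<lambda>x. x 0 ^ (d - 3) * l x)"
    have fv: "form r (d - 3 + Suc 0) v" unfolding v_def using r fl by (intro form_var_power) auto
    have "form r (d - 3 + 0) (\<lambda>x. x 0 ^ (d - 3) * 1)" using r by (intro form_var_power form.const) auto
    from form_mult_nonzero[OF this fl, of "\<lambda>_. 1" b] obtain y1 where y1: "v y1 \<noteq> 0"
      using \<open>l b \<noteq> 0\<close> by (auto simp: v_def)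
    have deg: "Suc (d - 3 + Suc 0) = d - 1" using d by simp
    have f: "form r (d - 1) (\<lambda>x. x i * v x)" if "i < r" for i
      using form.var[OF that fv] unfolding deg .
    have "indep2 (\<lambda>x. x 0 * v x) (\<lambda>x. x 1 * v x)"
      unfolding indep2_def
    proof (intro allI impI)
      fix c1 c2 assume c: "\<forall>x. c1 * (x 0 * v x) + c2 * (x 1 * v x) = 0"
      let ?c = "\<lambda>j. if j = 0 then c1 else if j = Suc 0 then c2 else 0"
      define L where "L = (\<lambda>x :: nat \<Rightarrow> real. \<Sum>j<r. ?c j * x j)"
      have L: "L x = c1 * x 0 + c2 * x 1" for x
      proof -
        have "L x = (\<Sum>j\<in>{0, 1}. ?c j * x j)"
          unfolding L_def using r by (intro sum.mono_neutral_right) auto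
        then show ?thesis by simp
      qed
      have Lv: "L x * v x = 0" for x using spec[OF c, of x] by (simp add: L algebra_simps)
      have "L x = 0" for x
      proof (rule ccontr)
        assume "L x \<noteq> 0"
        moreover have "form r (Suc 0) L" unfolding L_def by (rule form_linear)
        ultimately show False using form_mult_nonzero[OF _ fv _ y1, of "Suc 0" L x] Lv by blast
      qed
      from this[of "\<lambda>i. if i = 0 then 1 else 0"] this[of "\<lambda>i. if i = 1 then 1 else 0"]
      show "c1 = 0 \<and> c2 = 0" by (simp add: L)
    qed
    moreover have "v x = 0" if "p x = 0" for x using l0[OF that] by (simp add: v_def)
    ultimately show ?thesis using f[of 0] f[of 1] r
      by (intro exI[of _ "\<lambda>x. x 0 * v x"] exI[of _ "\<lambda>x. x 1 * v x"]) auto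
  qed
qed

text \<open>The \<open>r\<close> products of \<open>w1\<close> with the variables are independent,
  and some product \<open>x m * w2 x\<close> lies outside their span. Otherwise x_0 w2 and x_1 w2
  would be products of w1 with linear forms \<open>lin b\<close> and \<open>lin b'\<close>. Then x_1
  \<open>lin b\<close> equals x_0 \<open>lin b'\<close>, so \<open>lin b\<close> is a multiple of
  x_0 and w2 a multiple of w1.\<close>

lemma independent_multiples:
  assumes r: "2 \<le> r" and w: "form r e w1" "form r e w2" "indep2 w1 w2"
  shows "\<exists>q. (\<forall>j\<le>r. form r (Suc e) (q j)) \<and>
    (\<forall>c. (\<forall>x. (\<Sum>j\<le>r. c j * q j x) = 0) \<longrightarrow> (\<forall>j\<le>r. c j = 0)) \<and>
    (\<forall>x. w1 x = 0 \<and> w2 x = 0 \<longrightarrow> (\<forall>j\<le>r. q j x = 0))"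
proof -
  define lin :: "(nat \<Rightarrow> real) \<Rightarrow> (nat \<Rightarrow> real) \<Rightarrow> real" where "lin = (\<lambda>b x. \<Sum>j<r. b j * x j)"
  have flin: "form r (Suc 0) (lin b)" for b unfolding lin_def by (rule form_linear)
  have indD: "c1 = 0 \<and> c2 = 0" if "\<And>x. c1 * w1 x + c2 * w2 x = 0" for c1 c2
  proof -
    have "\<forall>x. c1 * w1 x + c2 * w2 x = 0" using that by (rule allI)
    then show ?thesis by (rule w(3)[unfolded indep2_def, THEN spec, THEN spec, THEN mp])
  qed
  have "\<exists>x. w1 x \<noteq> 0"
  proof (rule ccontr)
    assume "\<nexists>x. w1 x \<noteq> 0"
    then have "1 * w1 x + 0 * w2 x = 0" for x by simp
    from indD[OF this] show False by simp
  qed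
  then obtain y1 where y1: "w1 y1 \<noteq> 0" by blast
  have cancel: "f x = 0" if "form r d f" "\<And>x. f x * w1 x = 0" for f d x
    using form_mult_nonzero[OF that(1) w(1) _ y1, of x] that(2) by blast
  have unit: "lin b (\<lambda>j. if j = i then 1 else 0) = b i" if "i < r" for b i
  proof -
    have "lin b (\<lambda>j. if j = i then 1 else 0) = (\<Sum>j<r. if j = i then b j else 0)"
      unfolding lin_def by (rule sum.cong) auto
    then show ?thesis using that by simp
  qed
  have "\<exists>m<r. \<not> (\<exists>b. \<forall>x. x m * w2 x = lin b x * w1 x)"
  proof (rule ccontr)
    assume neg: "\<not> ?thesis"
    have ex: "\<exists>b. \<forall>x. x m * w2 x = lin b x * w1 x" if "m < r" for m using neg that by blast
    have "0 < r" "1 < r" using r by simp_all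
    obtain b where "\<forall>x. x 0 * w2 x = lin b x * w1 x" using ex[OF \<open>0 < r\<close>] ..
    then have b: "x 0 * w2 x = lin b x * w1 x" for x ..
    obtain b' where "\<forall>x. x 1 * w2 x = lin b' x * w1 x" using ex[OF \<open>1 < r\<close>] ..
    then have b': "x 1 * w2 x = lin b' x * w1 x" for x ..
    have "form r (Suc (Suc 0)) (\<lambda>x. x 1 * lin b x + (- 1) * (x 0 * lin b' x))"
      using r flin by (intro form.add form_scale form.var) auto
    moreover have "(x 1 * lin b x + (- 1) * (x 0 * lin b' x)) * w1 x = 0" for x
    proof -
      have "(x 1 * lin b x + (- 1) * (x 0 * lin b' x)) * w1 x
          = x 1 * (lin b x * w1 x) - x 0 * (lin b' x * w1 x)" by (simp add: algebra_simps)
      also have "\<dots> = 0" unfolding b[symmetric] b'[symmetric] by (simp add: mult.left_commute)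
      finally show ?thesis .
    qed
    ultimately have eq: "x 1 * lin b x + (- 1) * (x 0 * lin b' x) = 0" for x by (rule cancel)
    have b1: "b 1 = 0"
      using eq[of "\<lambda>j. if j = 1 then 1 else 0"] unit[of 1 b] r by simp
    have bj: "b j = 0" if j: "j < r" "j \<noteq> 0" for j
    proof (cases "j = 1")
      case False
      \<comment> \<open>A point with \<open>x 0 = 0\<close> and \<open>x 1 = 1\<close>, at which
        \<open>eq\<close> forces \<open>lin b x = 0\<close>; together with \<open>b 1 = 0\<close>
        this isolates \<open>b j\<close>.\<close>
      define x where "x = (\<lambda>i. if i = 1 \<or> i = j then 1 else 0 :: real)"
      have "lin b x = (\<Sum>i<r. (if i = 1 then b i else 0) + (if i = j then b i else 0))"
        unfolding lin_def using False by (intro sum.cong) (auto simp: x_def)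
      then have "lin b x = b 1 + b j" using j r by (simp add: sum.distrib)
      moreover have "x 0 = 0" "x 1 = 1" using j by (auto simp: x_def)
      ultimately show ?thesis using eq[of x] b1 by simp
    qed (use b1 in simp)
    have lb: "lin b x = b 0 * x 0" for x
    proof -
      have "lin b x = (\<Sum>j\<in>{0}. b j * x j)"
        unfolding lin_def using r bj by (intro sum.mono_neutral_right) auto
      then show ?thesis by simp
    qed
    have fdiff: "form r e (\<lambda>x. w2 x + (- b 0) * w1 x)"
      using w by (intro form.add form_scale)
    have f0: "form r (Suc 0) (\<lambda>x. x 0 * 1)" using r by (intro form.var form.const) auto
    have "w2 x + (- b 0) * w1 x = 0" for x
    proof (rule ccontr)
      assume "w2 x + (- b 0) * w1 x \<noteq> 0"
      from form_mult_nonzero[OF f0 fdiff, of "\<lambda>_. 1" x] this obtain y where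
        y: "y 0 * 1 * (w2 y + (- b 0) * w1 y) \<noteq> 0" by auto
      moreover have "y 0 * 1 * (w2 y + (- b 0) * w1 y) = 0"
        using b[of y] by (simp add: lb algebra_simps)
      ultimately show False by simp
    qed
    then have "(- b 0) * w1 x + 1 * w2 x = 0" for x by (simp add: add.commute)
    from indD[OF this] show False by simp
  qed
  then obtain m where m: "m < r" "\<And>b. \<exists>x. x m * w2 x \<noteq> lin b x * w1 x" by blast
  \<comment> \<open>The index \<open>r\<close> carries the one product with
    \<open>w2\<close>.\<close>
  define q where "q = (\<lambda>j x. if j < r then x j * w1 x else x m * w2 x)"
  have qsum: "(\<Sum>j\<le>r. c j * q j x) = lin c x * w1 x + c r * (x m * w2 x)" for c x
  proof -
    have "(\<Sum>j<r. c j * q j x) = lin c x * w1 x"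
      unfolding lin_def sum_distrib_right by (rule sum.cong) (auto simp: q_def)
    then show ?thesis by (simp add: lessThan_Suc_atMost[symmetric] q_def)
  qed
  have "form r (Suc e) (q j)" for j
    unfolding q_def using w m(1) by (cases "j < r") (auto intro: form.var)
  moreover have "\<forall>j\<le>r. c j = 0" if c: "\<forall>x. (\<Sum>j\<le>r. c j * q j x) = 0" for c
  proof -
    have "c r = 0"
    proof (rule ccontr)
      assume "c r \<noteq> 0"
      have "lin (\<lambda>j. - c j / c r) x * w1 x = x m * w2 x" for x
      proof -
        have "lin (\<lambda>j. - c j / c r) x = - lin c x / c r"
          by (simp add: lin_def sum_negf sum_divide_distrib)
        moreover have "lin c x * w1 x = - (c r * (x m * w2 x))" using c qsum[of c x] by simp
        ultimately have "lin (\<lambda>j. - c j / c r) x * w1 x = c r * (x m * w2 x) / c r" by simp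
        then show ?thesis using \<open>c r \<noteq> 0\<close> by simp
      qed
      then show False using m(2) by metis
    qed
    then have "lin c x * w1 x = 0" for x using c qsum[of c x] by simp
    then have "lin c x = 0" for x by (rule cancel[OF flin])
    then have "c j = 0" if "j < r" for j using unit[OF that, of c] by simp
    then show ?thesis using \<open>c r = 0\<close> le_eq_less_or_eq by auto
  qed
  moreover have "q j x = 0" if "w1 x = 0 \<and> w2 x = 0" for j x
    using that by (simp add: q_def)
  ultimately show ?thesis by (intro exI[of _ q]) auto
qed

text \<open>The vectors of monomial values at the points of \<open>J\<close> are orthogonal to the
  independent coefficient vectors of the \<open>q j\<close>. Together these vectors are too many to
  be independent. In a relation among them the two parts are orthogonal and opposite, so each is 0,
  and a nonzero coefficient must sit on a point.\<close>

lemma dependent_on_zeros: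
  assumes q: "\<And>j. j \<in> I \<Longrightarrow> form r d (q j)"
    and ind: "\<And>c. (\<And>x. (\<Sum>j\<in>I. c j * q j x) = 0) \<Longrightarrow> \<forall>j\<in>I. c j = 0"
    and fin: "finite I" "finite J" and zeros: "\<And>i j. i \<in> J \<Longrightarrow> j \<in> I \<Longrightarrow> q j (X i) = 0"
    and card: "card (monomials_eq r d) < card J + card I"
  shows "\<exists>c. (\<exists>i\<in>J. c i \<noteq> 0) \<and> (\<forall>\<alpha>\<in>monomials_eq r d. (\<Sum>i\<in>J. c i * form_monomial \<alpha> (X i)) = 0)"
proof -
  let ?E = "monomials_eq r d"
  have "\<forall>j. \<exists>c. j \<in> I \<longrightarrow> (\<forall>x. q j x = (\<Sum>\<alpha>\<in>?E. c \<alpha> * form_monomial \<alpha> x))"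
    using form_coeffs[OF q] by blast
  from choice[OF this] obtain Q where
    Q: "\<And>j x. j \<in> I \<Longrightarrow> q j x = (\<Sum>\<alpha>\<in>?E. Q j \<alpha> * form_monomial \<alpha> x)" by blast
  define M where "M = (\<lambda>\<alpha> s. case s of Inl i \<Rightarrow> form_monomial \<alpha> (X i) | Inr j \<Rightarrow> Q j \<alpha>)"
  have cardA: "card (J <+> I) = card J + card I" using fin by (simp add: card_Plus)
  obtain c where c: "\<exists>s\<in>J <+> I. c s \<noteq> 0" "\<And>\<alpha>. \<alpha> \<in> ?E \<Longrightarrow> (\<Sum>s\<in>J <+> I. M \<alpha> s * c s) = 0"
    using underdetermined_system[of ?E "J <+> I" M] fin card finite_monomials_eq cardA
    by (metis finite_Plus)
  define v where "v = (\<lambda>\<alpha>. \<Sum>j\<in>I. Q j \<alpha> * c (Inr j))"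
  define s where "s = (\<lambda>\<alpha>. \<Sum>i\<in>J. form_monomial \<alpha> (X i) * c (Inl i))"
  have sv: "s \<alpha> + v \<alpha> = 0" if "\<alpha> \<in> ?E" for \<alpha>
    using c(2)[OF that] fin by (simp add: sum.Plus M_def s_def v_def)
  have comb: "(\<Sum>j\<in>I. c (Inr j) * q j x) = (\<Sum>\<alpha>\<in>?E. v \<alpha> * form_monomial \<alpha> x)" for x
  proof -
    have "(\<Sum>j\<in>I. c (Inr j) * q j x) = (\<Sum>j\<in>I. \<Sum>\<alpha>\<in>?E. Q j \<alpha> * c (Inr j) * form_monomial \<alpha> x)"
      by (rule sum.cong) (simp_all add: Q sum_distrib_left mult.assoc mult.left_commute)
    also have "\<dots> = (\<Sum>\<alpha>\<in>?E. v \<alpha> * form_monomial \<alpha> x)"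
      by (subst sum.swap) (simp add: v_def sum_distrib_right)
    finally show ?thesis .
  qed
  \<comment> \<open>The pairing evaluates the combination of the \<open>q j\<close> at the points
    \<open>X i\<close>, where it is 0.\<close>
  have "(\<Sum>\<alpha>\<in>?E. v \<alpha> * s \<alpha>) = (\<Sum>i\<in>J. c (Inl i) * (\<Sum>\<alpha>\<in>?E. v \<alpha> * form_monomial \<alpha> (X i)))"
    by (simp add: s_def sum_distrib_left, subst sum.swap) (simp add: ac_simps)
  also have "\<dots> = 0"
    unfolding comb[symmetric] using zeros by simp
  finally have "(\<Sum>\<alpha>\<in>?E. v \<alpha> * v \<alpha>) = 0"
  proof -
    assume 0: "(\<Sum>\<alpha>\<in>?E. v \<alpha> * s \<alpha>) = 0"
    have "(\<Sum>\<alpha>\<in>?E. v \<alpha> * v \<alpha>) = (\<Sum>\<alpha>\<in>?E. - (v \<alpha> * s \<alpha>))"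
    proof (rule sum.cong)
      fix \<alpha> assume "\<alpha> \<in> ?E"
      then have "v \<alpha> = - s \<alpha>" using sv by (simp add: add_eq_0_iff)
      then show "v \<alpha> * v \<alpha> = - (v \<alpha> * s \<alpha>)" by simp
    qed simp
    then show ?thesis using 0 by (simp add: sum_negf)
  qed
  then have v0: "v \<alpha> = 0" if "\<alpha> \<in> ?E" for \<alpha>
    using that sum_nonneg_eq_0_iff[OF finite_monomials_eq, of r d "\<lambda>\<alpha>. v \<alpha> * v \<alpha>"] by auto
  have "\<forall>j\<in>I. c (Inr j) = 0" by (rule ind) (simp add: comb v0)
  then have "\<exists>i\<in>J. c (Inl i) \<noteq> 0" using c(1) by (auto simp: Plus_def)
  moreover have "(\<Sum>i\<in>J. c (Inl i) * form_monomial \<alpha> (X i)) = 0" if "\<alpha> \<in> ?E" for \<alpha>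
    using sv[OF that] v0[OF that] by (simp add: s_def mult.commute)
  ultimately show ?thesis by (intro exI[of _ "\<lambda>i. c (Inl i)"]) blast
qed

section \<open>The Veronese cone\<close>

definition cone_point :: "nat \<Rightarrow> nat \<Rightarrow> (nat \<Rightarrow> real) \<Rightarrow> (nat list \<Rightarrow>\<^sub>0 real)" where
  "cone_point r d x = monomial_vector (monomials_eq r d) (map x [0..<r])"

lemma lookup_cone_point:
  "Poly_Mapping.lookup (cone_point r d x) \<alpha> = (if \<alpha> \<in> monomials_eq r d then form_monomial \<alpha> x else 0)"
proof -
  have "monomial_value \<alpha> (map x [0..<r]) = form_monomial \<alpha> x" if "\<alpha> \<in> monomials_eq r d"
    unfolding monomial_value_def form_monomial_def
    using that by (intro prod.cong) (auto simp: monomials_eq_def)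
  then show ?thesis
    by (simp add: cone_point_def lookup_monomial_vector finite_monomials_eq)
qed

lemma veronese_cone_eq: "veronese_cone r d = range (cone_point r d)"
proof -
  have "{x :: real list. length x = r} = range (\<lambda>x. map x [0..<r])"
  proof (intro equalityI subsetI)
    fix y :: "real list" assume "y \<in> {x. length x = r}"
    then have "y = map ((!) y) [0..<r]" using map_nth[of y] by simp
    then show "y \<in> range (\<lambda>x. map x [0..<r])" by blast
  qed auto
  then show ?thesis unfolding veronese_cone_def cone_point_def by (simp add: image_image)
qed

lemma lookup_cone_sum:
  "Poly_Mapping.lookup (\<Sum>i\<in>I. w i *\<^sub>R cone_point r d (X i)) \<alpha>
    = (if \<alpha> \<in> monomials_eq r d then \<Sum>i\<in>I. w i * form_monomial \<alpha> (X i) else 0)"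
  by (simp add: lookup_sum lookup_scaleR lookup_cone_point)

lemma form_monomial_scale:
  assumes "\<alpha> \<in> monomials_eq r d"
  shows "form_monomial \<alpha> (\<lambda>i. s * x i) = s ^ d * form_monomial \<alpha> x"
  using form_homogeneous[OF form_form_monomial, of \<alpha> r s x] assms by (simp add: monomials_eq_def)

lemma cone_point_scale:
  assumes "0 \<le> c" "0 < d"
  shows "c *\<^sub>R cone_point r d x = cone_point r d (\<lambda>i. root d c * x i)"
  by (rule poly_mapping_eqI)
     (use assms in \<open>simp add: lookup_scaleR lookup_cone_point form_monomial_scale[where d = d]\<close>)

lemma cone_point_0:
  assumes "0 < d" shows "cone_point r d (\<lambda>_. 0) = 0"
  using cone_point_scale[of 0 d r "\<lambda>_. 0"] assms by simp

text \<open>No weights occur: for positive \<open>d\<close> a nonnegative weight is absorbed by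
  scaling the point with its \<open>d\<close>-th root, and surplus terms are filled with the zero
  point.\<close>

definition conic_comb :: "nat \<Rightarrow> nat \<Rightarrow> nat \<Rightarrow> (nat list \<Rightarrow>\<^sub>0 real) \<Rightarrow> bool" where
  "conic_comb r d N p \<longleftrightarrow> (\<exists>X. p = (\<Sum>i<N. cone_point r d (X i)))"

lemma conic_combI:
  assumes "finite I" "\<And>i. i \<in> I \<Longrightarrow> 0 \<le> w i" "card I \<le> N" "0 < d"
  shows "conic_comb r d N (\<Sum>i\<in>I. w i *\<^sub>R cone_point r d (X i))"
proof -
  obtain g where g: "bij_betw g {..<card I} I"
    using assms(1) by (metis ex_bij_betw_nat_finite atLeast0LessThan)
  let ?X = "\<lambda>j. if j < card I then (\<lambda>l. root d (w (g j)) * X (g j) l) else (\<lambda>_. 0)"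
  have "g j \<in> I" if "j < card I" for j using g that by (auto simp: bij_betw_def)
  then have eq: "cone_point r d (?X j) = w (g j) *\<^sub>R cone_point r d (X (g j))" if "j < card I" for j
    using that assms by (simp add: cone_point_scale)
  have "(\<Sum>j<N. cone_point r d (?X j)) = (\<Sum>j<card I. w (g j) *\<^sub>R cone_point r d (X (g j)))"
  proof (rule sum.mono_neutral_cong_right)
    show "{..<card I} \<subseteq> {..<N}" using assms(3) by auto
    show "\<forall>i\<in>{..<N} - {..<card I}. cone_point r d (?X i) = 0"
      using assms(4) by (auto simp: cone_point_0)
  qed (use eq in auto)
  also have "\<dots> = (\<Sum>i\<in>I. w i *\<^sub>R cone_point r d (X i))"
    using sum.reindex_bij_betw[OF g, of "\<lambda>i. w i *\<^sub>R cone_point r d (X i)"] .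
  finally show ?thesis unfolding conic_comb_def by (intro exI[of _ ?X]) simp
qed

lemma conic_comb_add:
  assumes "conic_comb r d M p" "conic_comb r d N q"
  shows "conic_comb r d (M + N) (p + q)"
proof -
  obtain X Y where XY: "p = (\<Sum>i<M. cone_point r d (X i))" "q = (\<Sum>i<N. cone_point r d (Y i))"
    using assms by (auto simp: conic_comb_def)
  have "(\<Sum>i<M + N. cone_point r d (if i < M then X i else Y (i - M))) = p + q"
    unfolding XY by (induction N) (simp_all add: add.assoc)
  then show ?thesis unfolding conic_comb_def by (intro exI[of _ "\<lambda>i. if i < M then X i else Y (i - M)"]) simp
qed

lemma conic_comb_scale:
  assumes "conic_comb r d N p" "0 \<le> c" "0 < d"
  shows "conic_comb r d N (c *\<^sub>R p)"
proof -
  obtain X where "p = (\<Sum>i<N. cone_point r d (X i))" using assms(1) by (auto simp: conic_comb_def)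
  then have "c *\<^sub>R p = (\<Sum>i<N. c *\<^sub>R cone_point r d (X i))" by (simp add: scaleR_sum_right)
  then show ?thesis using conic_combI[of "{..<N}" "\<lambda>_. c" N d r X] assms by simp
qed

text \<open>\<open>conic_reduction\<close> for points of the cone, with the relations stated
  coefficientwise, as \<open>dependent_on_zeros\<close> and plain dimension counts deliver
  them.\<close>

lemma conic_comb_reduce:
  fixes N :: nat
  assumes "0 < d" and
    "\<And>J. J \<subseteq> {..<N} \<Longrightarrow> M < card J \<Longrightarrow>
      \<exists>c. (\<exists>i\<in>J. c i \<noteq> 0) \<and> (\<forall>\<alpha>\<in>monomials_eq r d. (\<Sum>i\<in>J. c i * form_monomial \<alpha> (X i)) = 0)"
  shows "conic_comb r d M (\<Sum>i<N. cone_point r d (X i))"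
proof -
  have "\<exists>J w'. J \<subseteq> {..<N} \<and> card J \<le> M \<and> (\<forall>i\<in>J. 0 \<le> w' i) \<and>
      (\<Sum>i\<in>J. w' i *\<^sub>R cone_point r d (X i)) = (\<Sum>i<N. 1 *\<^sub>R cone_point r d (X i))"
  proof (rule conic_reduction)
    fix J assume J: "J \<subseteq> {..<N}" "M < card J"
    obtain c where c: "\<exists>i\<in>J. c i \<noteq> 0"
      "\<forall>\<alpha>\<in>monomials_eq r d. (\<Sum>i\<in>J. c i * form_monomial \<alpha> (X i)) = 0"
      using assms(2)[OF J] by (elim exE conjE)
    have "(\<Sum>i\<in>J. c i *\<^sub>R cone_point r d (X i)) = 0"
      by (rule poly_mapping_eqI) (use c(2) in \<open>simp add: lookup_cone_sum\<close>)
    with c(1) show "\<exists>c. (\<exists>i\<in>J. c i \<noteq> 0) \<and> (\<Sum>i\<in>J. c i *\<^sub>R cone_point r d (X i)) = 0"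
      by (intro exI[of _ c] conjI)
  qed auto
  then obtain J w' where J: "J \<subseteq> {..<N}" "card J \<le> M" "\<forall>i\<in>J. 0 \<le> w' i"
      "(\<Sum>i\<in>J. w' i *\<^sub>R cone_point r d (X i)) = (\<Sum>i<N. cone_point r d (X i))"
    unfolding scaleR_one by (elim exE conjE)
  have "conic_comb r d M (\<Sum>i\<in>J. w' i *\<^sub>R cone_point r d (X i))"
    using J(2,3) assms(1) finite_subset[OF J(1) finite_lessThan] by (intro conic_combI) auto
  then show ?thesis unfolding J(4) .
qed

lemma conic_comb_caratheodory:
  assumes "0 < d" "conic_comb r d N p"
  shows "conic_comb r d (card (monomials_eq r d)) p"
proof -
  obtain X where X: "p = (\<Sum>i<N. cone_point r d (X i))" using assms(2) by (auto simp: conic_comb_def)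
  show ?thesis unfolding X
  proof (rule conic_comb_reduce[OF assms(1)])
    fix J assume J: "J \<subseteq> {..<N}" "card (monomials_eq r d) < card J"
    from underdetermined_system[OF finite_monomials_eq finite_subset[OF J(1)] J(2), of "\<lambda>\<alpha> i. form_monomial \<alpha> (X i)"]
    show "\<exists>c. (\<exists>i\<in>J. c i \<noteq> 0) \<and> (\<forall>\<alpha>\<in>monomials_eq r d. (\<Sum>i\<in>J. c i * form_monomial \<alpha> (X i)) = 0)"
      by (simp add: mult.commute)
  qed
qed

lemma hull_conic_comb:
  assumes "0 < d" "p \<in> convex hull veronese_cone r d"
  shows "\<exists>N. conic_comb r d N p"
proof -
  obtain N where "convex_comb (veronese_cone r d) N p" using hull_imp_convex_comb[OF assms(2)] by blast
  then obtain w s where ws: "\<forall>i<N. 0 \<le> w i \<and> s i \<in> range (cone_point r d)" "p = (\<Sum>i<N. w i *\<^sub>R s i)"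
    unfolding convex_comb_def veronese_cone_eq by (elim exE conjE)
  have "\<forall>i. \<exists>x. i < N \<longrightarrow> s i = cone_point r d x" using ws(1) by blast
  then obtain X where X: "\<And>i. i < N \<Longrightarrow> s i = cone_point r d (X i)" by metis
  have "p = (\<Sum>i<N. w i *\<^sub>R cone_point r d (X i))" unfolding ws(2) using X by simp
  moreover have "conic_comb r d N (\<Sum>i<N. w i *\<^sub>R cone_point r d (X i))"
    using ws(1) assms(1) by (intro conic_combI) auto
  ultimately show ?thesis by blast
qed

text \<open>Equal weights \<open>1 / N\<close> are compensated by scaling each point with the
  \<open>d\<close>-th root of \<open>N\<close>, so the passage from conic to convex combinations
  costs no further point. Positivity of \<open>N\<close> is what lets the weights sum to 1.\<close>

lemma conic_comb_convex_comb:
  assumes "conic_comb r d N p" "0 < N" "0 < d"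
  shows "convex_comb (veronese_cone r d) N p"
proof -
  obtain X where X: "p = (\<Sum>i<N. cone_point r d (X i))" using assms(1) by (auto simp: conic_comb_def)
  let ?s = "\<lambda>i. cone_point r d (\<lambda>j. root d (real N) * X i j)"
  have "(1 / real N) *\<^sub>R ?s i = cone_point r d (X i)" for i
    using assms by (simp add: cone_point_scale[symmetric])
  then have "p = (\<Sum>i<N. (1 / real N) *\<^sub>R ?s i)" using X by simp
  then show ?thesis unfolding convex_comb_def veronese_cone_eq
    using assms(2) by (intro exI[of _ "\<lambda>_. 1 / real N"] exI[of _ ?s]) auto
qed

text \<open>The coordinates of \<open>p\<close> are entries of an \<open>r\<close> by
  \<open>r\<close> second moment matrix, and a decomposition of that matrix into \<open>r\<close>
  squares is a representation of \<open>p\<close> by \<open>r\<close> points.\<close>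

lemma conic_comb_quadratic:
  assumes "conic_comb r 2 N p"
  shows "conic_comb r 2 r p"
proof -
  obtain X where X: "p = (\<Sum>i<N. cone_point r 2 (X i))" using assms by (auto simp: conic_comb_def)
  define B where "B = (\<lambda>a b. \<Sum>i<N. X i a * X i b)"
  have "\<exists>u. \<forall>a\<in>{..<r}. \<forall>b\<in>{..<r}. B a b = (\<Sum>j\<in>{..<r}. u j a * u j b)"
  proof (rule psd_sum_of_squares)
    show "B a b = B b a" for a b by (simp add: B_def mult.commute)
    show "0 \<le> (\<Sum>a<r. \<Sum>b<r. c a * c b * B a b)" for c
    proof -
      have "(\<Sum>a<r. \<Sum>b<r. c a * c b * B a b) = (\<Sum>a<r. \<Sum>b<r. \<Sum>i<N. (c a * X i a) * (c b * X i b))"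
        by (simp add: B_def sum_distrib_left algebra_simps)
      also have "\<dots> = (\<Sum>a<r. \<Sum>i<N. \<Sum>b<r. (c a * X i a) * (c b * X i b))"
        by (intro sum.cong refl sum.swap)
      also have "\<dots> = (\<Sum>i<N. \<Sum>a<r. \<Sum>b<r. (c a * X i a) * (c b * X i b))"
        by (rule sum.swap)
      also have "\<dots> = (\<Sum>i<N. (\<Sum>a<r. c a * X i a)\<^sup>2)"
        unfolding power2_eq_square sum_product ..
      also have "\<dots> \<ge> 0" by (intro sum_nonneg) auto
      finally show ?thesis .
    qed
  qed simp
  then obtain u where u: "\<And>a b. a < r \<Longrightarrow> b < r \<Longrightarrow> B a b = (\<Sum>j<r. u j a * u j b)" by auto
  have mon: "\<exists>a<r. \<exists>b<r. \<forall>x. form_monomial \<alpha> x = x a * x b" if "\<alpha> \<in> monomials_eq r 2" for \<alpha>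
  proof -
    have \<alpha>: "length \<alpha> = r" "sum_list \<alpha> = 2" using that by (auto simp: monomials_eq_def)
    have raise: "form_monomial (\<beta>[a := Suc (\<beta> ! a)]) x = x a * form_monomial \<beta> x" if "a < length \<beta>" for a \<beta> x
      using prod_raise[OF that, of x] by (simp add: form_monomial_def)
    obtain a \<beta> where ab: "a < length \<alpha>" "length \<beta> = length \<alpha>" "\<alpha> = \<beta>[a := Suc (\<beta> ! a)]"
      "sum_list \<alpha> = Suc (sum_list \<beta>)" using exponent_lower[of \<alpha>] \<alpha>(2) by (metis zero_neq_numeral)
    have "sum_list \<beta> \<noteq> 0" using ab(4) \<alpha>(2) by linarith
    then obtain b \<gamma> where bc: "b < length \<beta>" "length \<gamma> = length \<beta>" "\<beta> = \<gamma>[b := Suc (\<gamma> ! b)]"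
      "sum_list \<beta> = Suc (sum_list \<gamma>)" by (rule exponent_lower)
    have "sum_list \<gamma> = 0" using ab(4) bc(4) \<alpha>(2) by linarith
    then have "form_monomial \<gamma> x = 1" for x by (auto simp: form_monomial_def all_set_conv_all_nth intro!: prod.neutral)
    moreover have "form_monomial \<beta> x = x b * form_monomial \<gamma> x" for x
      using raise[of b \<gamma> x] bc(1,2) unfolding bc(3)[symmetric] by linarith
    moreover have "form_monomial \<alpha> x = x a * form_monomial \<beta> x" for x
      using raise[of a \<beta> x] ab(1,2) unfolding ab(3)[symmetric] by linarith
    ultimately have "\<forall>x. form_monomial \<alpha> x = x a * x b" by simp
    then show ?thesis using ab(1,2) bc(1) \<alpha>(1) by metis
  qed
  have "p = (\<Sum>j<r. cone_point r 2 (u j))"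
  proof (rule poly_mapping_eqI)
    fix \<alpha>
    show "Poly_Mapping.lookup p \<alpha> = Poly_Mapping.lookup (\<Sum>j<r. cone_point r 2 (u j)) \<alpha>"
    proof (cases "\<alpha> \<in> monomials_eq r 2")
      case True
      then obtain a b where ab: "a < r" "b < r" "\<forall>x. form_monomial \<alpha> x = x a * x b" using mon by blast
      then show ?thesis using True u[OF ab(1,2)]
        by (simp add: X lookup_sum lookup_cone_point B_def)
    qed (simp add: X lookup_sum lookup_cone_point)
  qed
  then show ?thesis by (auto simp: conic_comb_def)
qed

section \<open>Maximal removal of a point, and the supporting form\<close>

definition pure_power :: "nat \<Rightarrow> nat \<Rightarrow> nat \<Rightarrow> nat list" where
  "pure_power r d j = (replicate r 0)[j := d]"

lemma pure_power_in: "j < r \<Longrightarrow> pure_power r d j \<in> monomials_eq r d"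
  by (simp add: pure_power_def monomials_eq_def sum_list_update sum_list_replicate)

lemma form_monomial_pure_power:
  assumes "j < r"
  shows "form_monomial (pure_power r d j) x = x j ^ d"
proof -
  have "form_monomial (pure_power r d j) x = (\<Prod>l<r. if l = j then x j ^ d else 1)"
    unfolding form_monomial_def pure_power_def by (rule prod.cong) (auto simp: nth_list_update)
  then show ?thesis using assms by simp
qed

text \<open>Makes the point removed below a coordinate vector: subtracting a multiple of it changes
  only the coordinate of the \<open>d\<close>-th power of the first variable.\<close>

lemma form_monomial_first_unit:
  assumes "\<alpha> \<in> monomials_eq r d" "0 < r" "\<alpha> \<noteq> pure_power r d 0"
  shows "form_monomial \<alpha> (\<lambda>i. if i = 0 then 1 else 0) = 0"
proof (rule ccontr)
  assume nz: "\<not> ?thesis"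
  have len: "length \<alpha> = r" "sum_list \<alpha> = d" using assms(1) by (auto simp: monomials_eq_def)
  have "\<alpha> ! i = 0" if "i < r" "i \<noteq> 0" for i
  proof (rule ccontr)
    assume "\<alpha> ! i \<noteq> 0"
    then have "form_monomial \<alpha> (\<lambda>i. if i = 0 then 1 else 0) = 0"
      unfolding form_monomial_def using that len by (intro prod_zero) (auto intro!: bexI[of _ i])
    then show False using nz by simp
  qed
  then have \<alpha>: "\<alpha> = (replicate r 0)[0 := \<alpha> ! 0]"
    using len(1) by (intro nth_equalityI) (auto simp: nth_list_update)
  then have "sum_list \<alpha> = sum_list ((replicate r 0)[0 := \<alpha> ! 0])" by (rule arg_cong)
  also have "\<dots> = \<alpha> ! 0" using assms(2) by (simp add: sum_list_update sum_list_replicate)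
  finally have "\<alpha> ! 0 = d" using len(2) by simp
  with \<alpha> have "\<alpha> = pure_power r d 0" by (simp only: pure_power_def)
  then show False using assms(3) by simp
qed

text \<open>Tychonoff's theorem. A whole family of points will be encoded as one function on index
  pairs.\<close>

lemma compact_box: "compact {X :: 'i \<Rightarrow> real. \<forall>i. \<bar>X i\<bar> \<le> R}"
proof -
  have "compactin (product_topology (\<lambda>_. euclideanreal) UNIV) (PiE UNIV (\<lambda>_ :: 'i. {- R..R}))"
    by (simp add: compactin_PiE)
  then have "compact (PiE UNIV (\<lambda>_ :: 'i. {- R..R}))"
    by (simp add: euclidean_product_topology)
  moreover have "PiE UNIV (\<lambda>_ :: 'i. {- R..R}) = {X. \<forall>i. \<bar>X i\<bar> \<le> R}"
  proof -
    have "a \<in> {- R..R} \<longleftrightarrow> \<bar>a\<bar> \<le> R" for a by auto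
    then show ?thesis by (simp only: PiE_UNIV_domain Pi_def UNIV_I simp_thms)
  qed
  ultimately show ?thesis by simp
qed

text \<open>Remove as much of the point \<open>(1, 0, ..., 0)\<close> as possible; all representations with
  \<open>card (monomials_eq r d)\<close> terms form a compact set because \<open>d\<close> is even.\<close>

lemma subtract_maximal:
  fixes p :: "nat list \<Rightarrow>\<^sub>0 real" and r d :: nat
  defines "v \<equiv> cone_point r d (\<lambda>i. if i = 0 then 1 else 0)"
  assumes d: "even d" "0 < d" and r: "0 < r" and p: "conic_comb r d N p"
  shows "\<exists>X s. 0 \<le> s \<and> p = s *\<^sub>R v + (\<Sum>i<card (monomials_eq r d). cone_point r d (X i)) \<and>
    (\<forall>\<epsilon>>0. \<forall>M. \<not> conic_comb r d M ((\<Sum>i<card (monomials_eq r d). cone_point r d (X i)) - \<epsilon> *\<^sub>R v))"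
proof -
  define m where "m = card (monomials_eq r d)"
  define E where "E = monomials_eq r d - {pure_power r d 0}"
  let ?l = "Poly_Mapping.lookup"
  \<comment> \<open>The only coordinate affected by removing multiples of \<open>v\<close>;
    minimising it over \<open>K\<close> removes as much as possible.\<close>
  define f where "f = (\<lambda>Y :: nat \<times> nat \<Rightarrow> real. \<Sum>i<m. Y (i, 0) ^ d)"
  define mom where "mom = (\<lambda>\<alpha> (Y :: nat \<times> nat \<Rightarrow> real). \<Sum>i<m. form_monomial \<alpha> (\<lambda>j. Y (i, j)))"
  have pp0: "pure_power r d 0 \<in> monomials_eq r d" using r by (rule pure_power_in)
  \<comment> \<open>Bounds all points at once: for even \<open>d\<close>, the \<open>d\<close>-th
    powers of the \<open>j\<close>-th entries are nonnegative and their sum is at most the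
    coordinate of \<open>p\<close> at \<open>pure_power r d j\<close>. Including 1 ensures that a
    number above \<open>R\<close> does not exceed its own \<open>d\<close>-th power.\<close>
  define R where "R = Max (insert 1 ((\<lambda>j. ?l p (pure_power r d j)) ` {..<r}))"
  have R1: "1 \<le> R" unfolding R_def by (intro Max_ge) auto
  have Rj: "?l p (pure_power r d j) \<le> R" if "j < r" for j
    unfolding R_def using that by (intro Max_ge) auto
  define F where "F = {Y. (\<forall>\<alpha>\<in>E. mom \<alpha> Y = ?l p \<alpha>) \<and> f Y \<le> ?l p (pure_power r d 0)}"
  define K where "K = {Y. \<forall>i. \<bar>Y i\<bar> \<le> R} \<inter> F"
  have cont: "continuous_on UNIV (mom \<alpha>)" for \<alpha>
    unfolding mom_def form_monomial_def by (intro continuous_intros continuous_on_product_coordinates)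
  have contf: "continuous_on UNIV f"
    unfolding f_def by (intro continuous_intros continuous_on_product_coordinates)
  have "closed F"
  proof -
    have "F = (\<Inter>\<alpha>\<in>E. {Y. mom \<alpha> Y = ?l p \<alpha>}) \<inter> {Y. f Y \<le> ?l p (pure_power r d 0)}"
      by (auto simp: F_def)
    then show ?thesis
      by (simp only:) (intro closed_Int closed_INT ballI closed_Collect_eq closed_Collect_le cont contf
        continuous_on_const)
  qed
  then have "compact K" unfolding K_def using compact_box by (intro compact_Int_closed)
  \<comment> \<open>Entries outside these index ranges do not influence the moments, but they could
    leave the compact box.\<close>
  define clip where "clip = (\<lambda>X (i :: nat, j). if i < m \<and> j < r then X i j else (0::real))"
  have mom_clip: "mom \<alpha> (clip X) = ?l (\<Sum>i<m. cone_point r d (X i)) \<alpha>" if "\<alpha> \<in> monomials_eq r d" for X \<alpha>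
  proof -
    have "form_monomial \<alpha> (\<lambda>j. clip X (i, j)) = form_monomial \<alpha> (X i)" if "i < m" for i
      unfolding form_monomial_def using that \<open>\<alpha> \<in> monomials_eq r d\<close>
      by (intro prod.cong) (auto simp: clip_def monomials_eq_def)
    then show ?thesis using that by (simp add: mom_def lookup_sum lookup_cone_point)
  qed
  have f_mom: "f Y = mom (pure_power r d 0) Y" for Y
    unfolding f_def mom_def using r by (simp add: form_monomial_pure_power)
  have in_K: "clip X \<in> K"
    if X: "\<And>\<alpha>. \<alpha> \<in> E \<Longrightarrow> ?l (\<Sum>i<m. cone_point r d (X i)) \<alpha> = ?l p \<alpha>"
      and X0: "?l (\<Sum>i<m. cone_point r d (X i)) (pure_power r d 0) \<le> ?l p (pure_power r d 0)" for X
  proof -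
    have le: "?l (\<Sum>i<m. cone_point r d (X i)) \<alpha> \<le> ?l p \<alpha>" if "\<alpha> \<in> monomials_eq r d" for \<alpha>
      using X[of \<alpha>] X0 that by (cases "\<alpha> = pure_power r d 0") (auto simp: E_def)
    have "\<bar>X i j\<bar> \<le> R" if ij: "i < m" "j < r" for i j
    proof (rule ccontr)
      assume "\<not> \<bar>X i j\<bar> \<le> R"
      then have big: "R < \<bar>X i j\<bar>" by simp
      have "\<bar>X i j\<bar> ^ 1 \<le> \<bar>X i j\<bar> ^ d" using big R1 d(2) by (intro power_increasing) auto
      also have "\<bar>X i j\<bar> ^ d = X i j ^ d" using d(1) by (rule power_even_abs)
      also have "\<dots> \<le> (\<Sum>i<m. X i j ^ d)"
        using ij(1) d(1) by (intro member_le_sum) (auto simp: zero_le_even_power)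
      also have "\<dots> = ?l (\<Sum>i<m. cone_point r d (X i)) (pure_power r d j)"
        using ij(2) by (simp add: lookup_sum lookup_cone_point pure_power_in form_monomial_pure_power)
      also have "\<dots> \<le> R" using le[OF pure_power_in[OF ij(2)]] Rj[OF ij(2)] by simp
      finally show False using big by simp
    qed
    then have "\<forall>i. \<bar>clip X i\<bar> \<le> R" using R1 by (auto simp: clip_def)
    moreover have "\<forall>\<alpha>\<in>E. mom \<alpha> (clip X) = ?l p \<alpha>" using X mom_clip by (simp add: E_def)
    moreover have "f (clip X) \<le> ?l p (pure_power r d 0)"
      unfolding f_mom mom_clip[OF pp0] by (rule X0)
    ultimately show ?thesis by (simp add: K_def F_def)
  qed
  obtain X0 where X0: "p = (\<Sum>i<m. cone_point r d (X0 i))"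
    using conic_comb_caratheodory[OF d(2) p] by (auto simp: conic_comb_def m_def)
  have "clip X0 \<in> K" by (rule in_K) (simp_all add: X0)
  then have "K \<noteq> {}" by blast
  obtain Y where Y: "Y \<in> K" "\<And>Y'. Y' \<in> K \<Longrightarrow> f Y \<le> f Y'"
    using continuous_attains_inf[OF \<open>compact K\<close> \<open>K \<noteq> {}\<close>] continuous_on_subset[OF contf subset_UNIV]
    by metis
  define X where "X = (\<lambda>i j. Y (i, j))"
  define z where "z = (\<Sum>i<m. cone_point r d (X i))"
  have lz: "?l z \<alpha> = (if \<alpha> \<in> monomials_eq r d then mom \<alpha> Y else 0)" for \<alpha>
    by (simp add: z_def lookup_sum lookup_cone_point mom_def X_def)
  have lv: "?l v \<alpha> = (if \<alpha> = pure_power r d 0 then 1 else 0)" for \<alpha>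
    using form_monomial_first_unit[OF _ r, of \<alpha> d] pp0 form_monomial_pure_power[OF r]
    by (auto simp: v_def lookup_cone_point)
  have lp: "?l p \<alpha> = 0" if "\<alpha> \<notin> monomials_eq r d" for \<alpha>
    using that by (simp add: X0 lookup_sum lookup_cone_point)
  define s where "s = ?l p (pure_power r d 0) - f Y"
  have "0 \<le> s" using Y(1) by (simp add: s_def K_def F_def)
  have eq: "p = s *\<^sub>R v + z"
  proof (rule poly_mapping_eqI)
    fix \<alpha>
    consider "\<alpha> = pure_power r d 0" | "\<alpha> \<in> E" | "\<alpha> \<notin> monomials_eq r d" "\<alpha> \<noteq> pure_power r d 0"
      using pp0 by (auto simp: E_def)
    then show "?l p \<alpha> = ?l (s *\<^sub>R v + z) \<alpha>"
    proof cases
      case 1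
      then show ?thesis using pp0 by (simp add: lookup_add lookup_scaleR lv lz s_def f_mom)
    next
      case 2
      then show ?thesis using Y(1) by (simp add: lookup_add lookup_scaleR lv lz E_def K_def F_def)
    next
      case 3
      then show ?thesis by (simp add: lookup_add lookup_scaleR lv lz lp)
    qed
  qed
  \<comment> \<open>A further removal would give, after reduction to \<open>m\<close> points, an
    element of \<open>K\<close> with a smaller value of \<open>f\<close>.\<close>
  have max: "\<not> conic_comb r d M (z - \<epsilon> *\<^sub>R v)" if "0 < \<epsilon>" for \<epsilon> M
  proof
    assume "conic_comb r d M (z - \<epsilon> *\<^sub>R v)"
    from conic_comb_caratheodory[OF d(2) this] obtain X' where
      X': "(\<Sum>i<m. cone_point r d (X' i)) = z - \<epsilon> *\<^sub>R v"
      unfolding conic_comb_def m_def by metis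
    have lX': "?l (\<Sum>i<m. cone_point r d (X' i)) \<alpha> = ?l p \<alpha> - (s + \<epsilon>) * ?l v \<alpha>" for \<alpha>
      unfolding X' by (simp add: eq lookup_add lookup_minus lookup_scaleR algebra_simps)
    have "clip X' \<in> K"
      by (rule in_K) (use \<open>0 \<le> s\<close> that in \<open>simp_all add: lX' lv E_def\<close>)
    then have "f Y \<le> f (clip X')" by (rule Y(2))
    also have "\<dots> = ?l p (pure_power r d 0) - (s + \<epsilon>)"
      unfolding f_mom mom_clip[OF pp0] lX' by (simp add: lv)
    finally show False using that by (simp add: s_def)
  qed
  show ?thesis
    using \<open>0 \<le> s\<close> eq max unfolding z_def m_def by (intro exI[of _ X] exI[of _ s]) blast
qed

text \<open>Apply \<open>positive_functional\<close> to the cone generated by all points and by \<open>- z\<close>.\<close>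

lemma supporting_form:
  fixes m r d :: nat and x0
  defines "v \<equiv> cone_point r d x0"
  assumes d: "0 < d" and z: "z = (\<Sum>i<m. cone_point r d (X i))"
    and max: "\<And>\<epsilon> M. 0 < \<epsilon> \<Longrightarrow> \<not> conic_comb r d M (z - \<epsilon> *\<^sub>R v)"
  shows "\<exists>f. form r d f \<and> (\<forall>x. 0 \<le> f x) \<and> (\<exists>x. f x \<noteq> 0) \<and> (\<forall>i<m. f (X i) = 0)"
proof -
  define C where "C = {p. \<exists>N. conic_comb r d N p}"
  have C_point: "c *\<^sub>R cone_point r d x \<in> C" if "0 \<le> c" for c x
    using conic_combI[of "{0::nat}" "\<lambda>_. c" 1 d r "\<lambda>_. x"] that d by (auto simp: C_def)
  have C_add: "p + q \<in> C" if "p \<in> C" "q \<in> C" for p q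
    using that conic_comb_add unfolding C_def by blast
  have C_scale: "c *\<^sub>R p \<in> C" if "0 \<le> c" "p \<in> C" for c p
    using that conic_comb_scale d unfolding C_def by blast
  have C0: "0 \<in> C" using C_point[of 0] by simp
  have C_sum: "(\<Sum>i\<in>I. g i) \<in> C" if "\<And>i. i \<in> I \<Longrightarrow> g i \<in> C" for g and I :: "'b set"
    using that by (induction I rule: infinite_finite_induct) (auto intro: C0 C_add)
  have zC: "z \<in> C" unfolding z C_def conic_comb_def by blast
  have zmax: "z - \<epsilon> *\<^sub>R v \<notin> C" if "0 < \<epsilon>" for \<epsilon> using max[OF that] by (simp add: C_def)
  \<comment> \<open>A basis made of points of the cone, so that its nonnegative combinations stay in
    \<open>C\<close>.\<close>
  obtain B where B: "B \<subseteq> range (cone_point r d)" "independent B" "range (cone_point r d) \<subseteq> span B"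
    using maximal_independent_subset by blast
  let ?S = "(\<lambda>\<alpha>. Poly_Mapping.single \<alpha> (1::real)) ` monomials_eq r d"
  have "range (cone_point r d) \<subseteq> span ?S"
    using monomial_vector_in_span[OF finite_monomials_eq] by (auto simp: cone_point_def)
  then have "B \<subseteq> span ?S" using B(1) by blast
  then have fB: "finite B" using independent_span_bound[of ?S B] B(2) finite_monomials_eq by blast
  have BC: "b \<in> C" if b: "b \<in> B" for b
  proof -
    obtain x where "b = cone_point r d x" using b B(1) by blast
    then show ?thesis using C_point[of 1 x] by simp
  qed
  \<comment> \<open>An order unit: for every \<open>w\<close> in the span of \<open>B\<close>, some
    multiple of \<open>u\<close> minus \<open>w\<close> is a nonnegative combination of
    \<open>B\<close> and hence in \<open>C\<close>.\<close>
  define u where "u = \<Sum>B"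
  define K where "K = {c - s *\<^sub>R z | c s. c \<in> C \<and> 0 \<le> s}"
  have KI: "c - s *\<^sub>R z \<in> K" if "c \<in> C" "0 \<le> s" for c s using that by (auto simp: K_def)
  have CK: "c \<in> K" if "c \<in> C" for c using KI[OF that, of 0] by simp
  have K_add: "a + b \<in> K" if ab: "a \<in> K" "b \<in> K" for a b
  proof -
    obtain c s c' s' where cs: "a = c - s *\<^sub>R z" "b = c' - s' *\<^sub>R z" "c \<in> C" "c' \<in> C" "0 \<le> s" "0 \<le> s'"
      using ab by (auto simp: K_def)
    have "a + b = (c + c') - (s + s') *\<^sub>R z" by (simp add: cs scaleR_add_left)
    moreover have "(c + c') - (s + s') *\<^sub>R z \<in> K" using C_add cs by (intro KI) simp_all
    ultimately show ?thesis by (simp only:)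
  qed
  have K_scale: "t *\<^sub>R a \<in> K" if ta: "0 \<le> t" "a \<in> K" for t a
  proof -
    obtain c s where cs: "a = c - s *\<^sub>R z" "c \<in> C" "0 \<le> s" using ta(2) by (auto simp: K_def)
    have "t *\<^sub>R a = t *\<^sub>R c - (t * s) *\<^sub>R z" by (simp add: cs scaleR_diff_right)
    moreover have "t *\<^sub>R c - (t * s) *\<^sub>R z \<in> K" using C_scale cs ta(1) by (intro KI) simp_all
    ultimately show ?thesis by (simp only:)
  qed
  \<comment> \<open>Some nonnegative multiple of \<open>u\<close> dominates \<open>v\<close>, so
    \<open>- u\<close> in \<open>K\<close> would put \<open>- v\<close> in \<open>K\<close>; that
    is, \<open>s z - v\<close> would lie in \<open>C\<close> for some \<open>s >= 0\<close>.
    Dividing by \<open>s\<close>, or adding \<open>z\<close> if \<open>s = 0\<close>, contradicts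
    the maximality of the removal.\<close>
  have "- u \<notin> K"
  proof
    assume "- u \<in> K"
    have "v \<in> span B" using B(3) by (auto simp: v_def)
    then obtain c where c: "v = (\<Sum>b\<in>B. c b *\<^sub>R b)" using span_finite[OF fB] by auto
    define t where "t = Max (insert 0 (c ` B))"
    have t: "0 \<le> t" "\<And>b. b \<in> B \<Longrightarrow> c b \<le> t" unfolding t_def using fB by auto
    have "t *\<^sub>R u - v = (\<Sum>b\<in>B. (t - c b) *\<^sub>R b)"
      by (simp add: u_def c scaleR_sum_right scaleR_left_diff_distrib sum_subtractf)
    also have "\<dots> \<in> C" using t BC by (intro C_sum C_scale) auto
    finally have "t *\<^sub>R u - v \<in> C" .
    from K_add[OF CK[OF this] K_scale[OF t(1) \<open>- u \<in> K\<close>]] have "- v \<in> K" by simp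
    then obtain c s where cs: "- v = c - s *\<^sub>R z" "c \<in> C" "0 \<le> s" by (auto simp: K_def)
    then have c_eq: "c = s *\<^sub>R z - v" by (simp add: algebra_simps)
    show False
    proof (cases "s = 0")
      case True
      then have "z - 1 *\<^sub>R v = z + c" using c_eq by simp
      then show False using zmax[of 1] C_add[OF zC cs(2)] by (metis zero_less_one)
    next
      case False
      then have "z - (1 / s) *\<^sub>R v = (1 / s) *\<^sub>R c" using c_eq by (simp add: scaleR_diff_right)
      then show False using zmax[of "1 / s"] C_scale[of "1 / s" c] cs False by simp
    qed
  qed
  moreover have "\<exists>s. s *\<^sub>R u - b \<in> K \<and> s *\<^sub>R u + b \<in> K" if b: "b \<in> B" for b
  proof (intro exI conjI)
    have "u = b + \<Sum>(B - {b})" unfolding u_def using fB b by (simp add: sum.remove)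
    then have "1 *\<^sub>R u - b = \<Sum>(B - {b})" by simp
    also have "\<dots> \<in> C" using BC by (intro C_sum) auto
    finally show "1 *\<^sub>R u - b \<in> K" by (rule CK)
    have "u \<in> C" unfolding u_def using BC by (intro C_sum) auto
    then show "1 *\<^sub>R u + b \<in> K" using C_add BC[OF b] CK by simp
  qed
  ultimately have "\<exists>p :: (nat list \<Rightarrow>\<^sub>0 real) \<Rightarrow> real.
      linear p \<and> p u = 1 \<and> (\<forall>w\<in>K \<inter> span (insert u B). 0 \<le> p w)"
    using CK[OF C0] K_add K_scale by (intro positive_functional fB)
  then obtain p :: "(nat list \<Rightarrow>\<^sub>0 real) \<Rightarrow> real"
    where p: "linear p" "p u = 1" "\<And>w. w \<in> K \<Longrightarrow> w \<in> span (insert u B) \<Longrightarrow> 0 \<le> p w" by blast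
  have spB: "span B \<subseteq> span (insert u B)" by (rule span_mono) blast
  define f where "f = (\<lambda>x. p (cone_point r d x))"
  have in_span: "cone_point r d x \<in> span (insert u B)" for x using B(3) spB by blast
  have pos: "0 \<le> f x" for x
    unfolding f_def using C_point[of 1 x] in_span by (intro p(3) CK) simp_all
  have "form r d f"
  proof -
    have "f x = (\<Sum>\<alpha>\<in>monomials_eq r d. p (Poly_Mapping.single \<alpha> 1) * form_monomial \<alpha> x)" for x
    proof -
      have "cone_point r d x = (\<Sum>\<alpha>\<in>monomials_eq r d. form_monomial \<alpha> x *\<^sub>R Poly_Mapping.single \<alpha> 1)"
      proof (rule poly_mapping_eqI)
        fix \<alpha>
        have "(\<Sum>\<beta>\<in>monomials_eq r d. form_monomial \<beta> x * (if \<beta> = \<alpha> then 1 else 0))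
            = (\<Sum>\<beta>\<in>monomials_eq r d. if \<beta> = \<alpha> then form_monomial \<alpha> x else 0)"
          by (rule sum.cong) auto
        then show "Poly_Mapping.lookup (cone_point r d x) \<alpha> =
          Poly_Mapping.lookup (\<Sum>\<alpha>\<in>monomials_eq r d. form_monomial \<alpha> x *\<^sub>R Poly_Mapping.single \<alpha> 1) \<alpha>"
          by (simp add: lookup_cone_point lookup_sum lookup_scaleR lookup_single when_def finite_monomials_eq)
      qed
      then show ?thesis
        by (simp add: f_def linear_sum[OF p(1)] linear_scale[OF p(1)] mult.commute)
    qed
    then have f: "f = (\<lambda>x. \<Sum>\<alpha>\<in>monomials_eq r d. p (Poly_Mapping.single \<alpha> 1) * form_monomial \<alpha> x)"
      by (rule ext)
    show ?thesis unfolding f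
    proof (intro form_sum form_scale)
      fix \<alpha> assume "\<alpha> \<in> monomials_eq r d"
      then show "form r d (form_monomial \<alpha>)"
        using form_form_monomial[of \<alpha> r] by (simp add: monomials_eq_def)
    qed
  qed
  moreover have "\<exists>x. f x \<noteq> 0"
  proof (rule ccontr)
    assume "\<nexists>x. f x \<noteq> 0"
    then have "p b = 0" if "b \<in> B" for b using that B(1) by (auto simp: f_def)
    then have "p u = 0" by (simp add: u_def linear_sum[OF p(1)])
    then show False using p(2) by simp
  qed
  moreover have "f (X i) = 0" if "i < m" for i
  proof -
    have pz: "p z = (\<Sum>i<m. f (X i))" by (simp add: z f_def linear_sum[OF p(1)])
    have "z \<in> span (insert u B)" unfolding z by (intro span_sum in_span)
    \<comment> \<open>\<open>- z\<close> is in \<open>K\<close>, so \<open>p z <= 0\<close>, while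
      \<open>p z\<close> is a sum of nonnegative values of \<open>f\<close>; hence all of them are
      0.\<close>
    then have "0 \<le> p (- z)" using KI[OF C0, of 1] by (intro p(3)) (simp_all add: span_neg)
    then have "p z \<le> 0" by (simp add: linear_neg[OF p(1)])
    moreover have "0 \<le> (\<Sum>i<m. f (X i))" using pos by (intro sum_nonneg)
    ultimately have "(\<Sum>i<m. f (X i)) = 0" using pz by simp
    then show ?thesis using that pos by (simp add: sum_nonneg_eq_0_iff)
  qed
  ultimately show ?thesis using pos by blast
qed

text \<open>The remainder costs \<open>m - (r + 1)\<close> points and the removed point one more.
  The strict inequality in the conclusion keeps the truncated subtraction genuine and the number of
  points positive, as \<open>conic_comb_convex_comb\<close> demands.\<close>

lemma conic_comb_bound:
  assumes r: "2 \<le> r" and d: "even d" "4 \<le> d" and p: "conic_comb r d N p"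
  shows "r < card (monomials_eq r d) \<and> conic_comb r d (card (monomials_eq r d) - r) p"
proof -
  define m where "m = card (monomials_eq r d)"
  define v where "v = cone_point r d (\<lambda>i. if i = 0 then 1 else 0)"
  have d0: "0 < d" "3 \<le> d" and r0: "0 < r" using d r by simp_all
  obtain X s where s: "0 \<le> s" and eq: "p = s *\<^sub>R v + (\<Sum>i<m. cone_point r d (X i))"
    and max: "\<And>\<epsilon> M. 0 < \<epsilon> \<Longrightarrow> \<not> conic_comb r d M ((\<Sum>i<m. cone_point r d (X i)) - \<epsilon> *\<^sub>R v)"
    using subtract_maximal[OF d(1) d0(1) r0 p] unfolding m_def v_def by blast
  obtain f where f: "form r d f" "\<And>x. 0 \<le> f x" "\<exists>x. f x \<noteq> 0" "\<And>i. i < m \<Longrightarrow> f (X i) = 0"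
    using supporting_form[OF d0(1) refl max[unfolded v_def]] by blast
  obtain x0 where "f x0 \<noteq> 0" using f(3) by blast
  from nonneg_form_vanishing_pair[OF r d0(2) f(1,2) this] obtain w1 w2 where
    w: "form r (d - 1) w1" "form r (d - 1) w2" "indep2 w1 w2" "\<And>x. f x = 0 \<Longrightarrow> w1 x = 0 \<and> w2 x = 0"
    by blast
  have "Suc (d - 1) = d" using d0 by simp
  with independent_multiples[OF r w(1-3)] obtain q where
    q: "\<And>j. j \<le> r \<Longrightarrow> form r d (q j)"
      "\<And>c. \<forall>x. (\<Sum>j\<le>r. c j * q j x) = 0 \<Longrightarrow> \<forall>j\<le>r. c j = (0::real)"
      "\<And>x. w1 x = 0 \<and> w2 x = 0 \<Longrightarrow> \<forall>j\<le>r. q j x = 0" by auto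
  have dep: "\<exists>c. (\<exists>i\<in>J. c i \<noteq> 0) \<and> (\<forall>\<alpha>\<in>monomials_eq r d. (\<Sum>i\<in>J. c i * form_monomial \<alpha> (X i)) = 0)"
    if J: "J \<subseteq> {..<m}" "m < card J + Suc r" for J
  proof (rule dependent_on_zeros[where I = "{..r}" and q = q])
    show "\<forall>j\<in>{..r}. c j = 0" if "\<And>x. (\<Sum>j\<in>{..r}. c j * q j x) = 0" for c
      using q(2)[of c] that by simp
    show "q j (X i) = 0" if "i \<in> J" "j \<in> {..r}" for i j
      using q(3)[OF w(4)[OF f(4)]] that J(1) by auto
  qed (use q(1) J finite_subset[OF J(1)] in \<open>auto simp: m_def\<close>)
  \<comment> \<open>With at most \<open>r\<close> monomials even the empty set of points would be
    dependent.\<close>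
  have rm: "r < m"
  proof (rule ccontr)
    assume "\<not> r < m"
    then show False using dep[of "{}"] by auto
  qed
  have "conic_comb r d (m - Suc r) (\<Sum>i<m. cone_point r d (X i))"
  proof (rule conic_comb_reduce[OF d0(1)])
    show "\<exists>c. (\<exists>i\<in>J. c i \<noteq> 0) \<and> (\<forall>\<alpha>\<in>monomials_eq r d. (\<Sum>i\<in>J. c i * form_monomial \<alpha> (X i)) = 0)"
      if "J \<subseteq> {..<m}" "m - Suc r < card J" for J
      using that by (intro dep) auto
  qed
  moreover have "conic_comb r d 1 (s *\<^sub>R v)"
    using conic_combI[of "{0::nat}" "\<lambda>_. s" 1 d r] s d0(1) unfolding v_def by simp
  ultimately have "conic_comb r d (1 + (m - Suc r)) p" unfolding eq by (intro conic_comb_add)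
  moreover have "1 + (m - Suc r) = m - r" using rm by simp
  ultimately show ?thesis using rm by (simp add: m_def)
qed

lemma card_monomials_eq: "card (monomials_eq (Suc n) d) = (n + d) choose n"
  using bij_betw_same_card[OF bij_betw_monomials] by (simp add: card_monomials_le)

text \<open>Degree two is separate because \<open>conic_comb_bound\<close> starts at degree 4. There
  \<open>n + 1\<close> points suffice, and \<open>n + 1\<close> is within the bound exactly when
  \<open>n >= 2\<close>; the excluded case is the one left over.\<close>

lemma caratheodory_veronese_cone_le:
  assumes "1 \<le> n" "1 \<le> k" "\<not> (n = 1 \<and> k = 1)"
  shows "int (caratheodory_number (veronese_cone (n + 1) (2 * k))) \<le> int ((2 * k + n) choose n) - int n - 1"
proof (cases "k = 1")
  case True
  then have "2 \<le> n" using assms by simp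
  have "caratheodory_number (veronese_cone (n + 1) 2) \<le> n + 1"
  proof (rule caratheodory_number_le)
    fix x assume "x \<in> convex hull veronese_cone (n + 1) 2"
    then obtain N where "conic_comb (n + 1) 2 N x" using hull_conic_comb by fastforce
    then show "convex_comb (veronese_cone (n + 1) 2) (n + 1) x"
      by (intro conic_comb_convex_comb conic_comb_quadratic) simp_all
  qed
  moreover have "2 * n + 2 \<le> (2 + n) choose n"
  proof -
    have "(2 + n) choose n = (2 + n) choose 2" using binomial_symmetric[of n "2 + n"] by simp
    also have "\<dots> = (2 + n) * (1 + n) div 2" by (simp add: choose_two)
    also have "\<dots> \<ge> (2 * (2 * n + 2)) div 2"
    proof (rule div_le_mono)
      have "4 * (1 + n) \<le> (2 + n) * (1 + n)" using \<open>2 \<le> n\<close> by (intro mult_right_mono) auto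
      then show "2 * (2 * n + 2) \<le> (2 + n) * (1 + n)" by simp
    qed
    finally show ?thesis by simp
  qed
  ultimately show ?thesis using True by simp
next
  case False
  let ?m = "card (monomials_eq (n + 1) (2 * k))"
  have k: "even (2 * k)" "4 \<le> 2 * k" "0 < 2 * k" and n: "2 \<le> n + 1" using assms False by simp_all
  \<comment> \<open>The zero vector serves only to extract \<open>n + 1 < ?m\<close> from
    \<open>conic_comb_bound\<close>.\<close>
  have "conic_comb (n + 1) (2 * k) 0 0" by (simp add: conic_comb_def)
  from conic_comb_bound[OF n k(1,2) this] have m: "n + 1 < ?m" by simp
  have "caratheodory_number (veronese_cone (n + 1) (2 * k)) \<le> ?m - (n + 1)"
  proof (rule caratheodory_number_le)
    fix x assume "x \<in> convex hull veronese_cone (n + 1) (2 * k)"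
    from hull_conic_comb[OF k(3) this] obtain N where N: "conic_comb (n + 1) (2 * k) N x" ..
    show "convex_comb (veronese_cone (n + 1) (2 * k)) (?m - (n + 1)) x"
      using conic_comb_bound[OF n k(1,2) N] m k(3) by (intro conic_comb_convex_comb) auto
  qed
  moreover have "?m = (2 * k + n) choose n" using card_monomials_eq[of n "2 * k"] by (simp add: add.commute)
  ultimately show ?thesis using m by simp
qed

theorem theorem6:
  fixes n k :: nat
  assumes "n \<ge> 1" and "k \<ge> 1"
  shows "caratheodory_number (affine_veronese n 2) = n + 1 \<and>
    int (caratheodory_number (affine_veronese n (2 * k)))
      \<ge> int ((2 * k + n) choose n) - int n * int ((k + n) choose n) + int (n choose 2) \<and>
    (\<not> (n = 1 \<and> k = 1) \<longrightarrow>
      int (caratheodory_number (veronese_cone (n + 1) (2 * k)))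
        \<le> int ((2 * k + n) choose n) - int n - 1) \<and>
    caratheodory_number (affine_veronese n (2 * k))
      \<le> caratheodory_number (affine_veronese n (2 * k + 1)) \<and>
    caratheodory_number (affine_veronese n (2 * k + 1))
      \<le> caratheodory_number (affine_veronese n (2 * k + 2))"
proof (intro conjI impI)
  show "caratheodory_number (affine_veronese n 2) = n + 1"
    using caratheodory_affine_veronese_2_le caratheodory_affine_veronese_2_ge by (rule antisym)
  show "int ((2 * k + n) choose n) - int n * int ((k + n) choose n) + int (n choose 2)
      \<le> int (caratheodory_number (affine_veronese n (2 * k)))"
    using assms(2) by (rule caratheodory_affine_veronese_ge)
  show "int (caratheodory_number (veronese_cone (n + 1) (2 * k))) \<le> int ((2 * k + n) choose n) - int n - 1"
    if "\<not> (n = 1 \<and> k = 1)"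
    using assms that by (rule caratheodory_veronese_cone_le)
qed (rule caratheodory_affine_veronese_mono; simp)+

end
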